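(* Assume the Linear Independence Conjecture: the Riemann Hypothesis holds and the positive ordinates of distinct non-trivial zeros of $\zeta(s)$ are linearly independent over $\mathbb{Q}$. Let $\kappa\le 3/2$ be real. Then \[ \limsup_{x\to\infty}\frac{1}{x^{3/2-\kappa}}\int_1^x\frac{M(u)}{u^\kappa}du \ge c_\kappa + \frac12\sum_{\gamma}\frac{1}{|\rho(\rho-\kappa+1)\zeta'(\rho)|}, \] \[ \liminf_{x\to\infty}\frac{1}{x^{3/2-\kappa}}\int_1^x\frac{M(u)}{u^\kappa}du \le c_\kappa - \frac12\sum_{\gamma}\frac{1}{|\rho(\rho-\kappa+1)\zeta'(\rho)|}, \] where the sums run over the non-trivial zeros $\rho=\frac12+i\gamma$ of $\zeta(s)$, the term $\frac{1}{|\rho(\rho-\kappa+1)\zeta'(\rho)|}$ is interpreted as $+\infty$ when $\rho$ is a multiple zero, and $c_\kappa=\frac{2}{\zeta(1/2)}$ if $\kappa=3/2$ and $c_\kappa=0$ otherwise.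
   Context: $\mu(n)$ is the Möbius function and $M(x)=\sum_{n\le x}\mu(n)$. *)

theory Defs
  imports "HOL-Complex_Analysis.Complex_Analysis" "HOL-Computational_Algebra.Squarefree"
begin

definition moebius_mu :: "nat \<Rightarrow> int" where
  "moebius_mu n = (if squarefree n then (-1) ^ card (prime_factors n) else 0)"

definition mertens :: "real \<Rightarrow> real" where
  "mertens x = (\<Sum>n | n \<ge> 1 \<and> real n \<le> x. of_int (moebius_mu n))"

(* The analytic continuation of the Dirichlet series to the plane without the pole at 1.
   It is unique on that domain; the value at 1 is arbitrary and never used. *)
definition zeta :: "complex \<Rightarrow> complex" where
  "zeta = (SOME f. f holomorphic_on (- {1}) \<and>
     (\<forall>s. Re s > 1 \<longrightarrow> (\<lambda>n. 1 / of_nat (Suc n) powr s) sums f s))"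

definition nontrivial_zeros :: "complex set" where
  "nontrivial_zeros = {\<rho>. 0 < Re \<rho> \<and> Re \<rho> < 1 \<and> zeta \<rho> = 0}"

definition riemann_hypothesis :: bool where
  "riemann_hypothesis \<longleftrightarrow> (\<forall>\<rho>\<in>nontrivial_zeros. Re \<rho> = 1 / 2)"

definition linear_independence_conjecture :: bool where
  "linear_independence_conjecture \<longleftrightarrow> riemann_hypothesis \<and>
     module.independent (\<lambda>q x. real_of_rat q * x) {\<gamma>. \<gamma> > 0 \<and> (\<exists>\<rho>\<in>nontrivial_zeros. \<gamma> = Im \<rho>)}"

(* A zero is multiple iff the derivative vanishes there. The other two factors of the
   denominator are nonzero at every non-real zero. *)
definition zero_term :: "real \<Rightarrow> complex \<Rightarrow> ereal" where
  "zero_term \<kappa> \<rho> =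
     (if deriv zeta \<rho> = 0 then \<infinity>
      else ereal (1 / norm (\<rho> * (\<rho> - of_real \<kappa> + 1) * deriv zeta \<rho>)))"

definition zero_sum :: "real \<Rightarrow> ereal" where
  "zero_sum \<kappa> = (\<Sum>\<^sub>\<infinity>\<rho>\<in>nontrivial_zeros. zero_term \<kappa> \<rho>)"

(* zeta (1/2) is a real number, so taking the real part only changes the type. *)
definition c_const :: "real \<Rightarrow> real" where
  "c_const \<kappa> = (if \<kappa> = 3 / 2 then Re (2 / zeta (1 / 2)) else 0)"

definition normalized_integral :: "real \<Rightarrow> real \<Rightarrow> real" where
  "normalized_integral \<kappa> x =
     1 / x powr (3 / 2 - \<kappa>) * integral {1..x} (\<lambda>u. mertens u / u powr \<kappa>)"

end

theory Submission
  imports Defs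
begin

text \<open>
  Put \<open>A(t) = x\<^bsup>\<kappa>-3/2\<^esup> \<integral>\<^sub>1\<^sup>x M(u) u\<^bsup>-\<kappa>\<^esup> du\<close> with \<open>x = e\<^sup>t\<close>. Its Laplace transform is \<open>L(s) = 1 / (w (w - \<kappa> + 1) \<zeta>(w))\<close>
  with \<open>w = s + 1/2\<close>. If \<open>A\<close> is bounded above, then Landau's theorem, which only needs \<open>\<zeta> \<noteq> 0\<close> on the
  real half-line \<open>w > 1/2\<close>, shows that the integral converges for \<open>Re s > 0\<close>. Hence
  \<open>\<delta> L(\<delta> + iy)\<close> tends to the residue of \<open>L\<close> at \<open>iy\<close> as \<open>\<delta>\<close> decreases to \<open>0\<close>, and all poles on the line are simple.
  Averaging \<open>C - A \<ge> 0\<close> against a Riesz product \<open>\<Prod>(1 + cos(\<gamma>t + \<phi>\<^sub>\<gamma>))\<close> over finitely many ordinates then gives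
  \<open>C \<ge> c\<^sub>\<kappa> + \<Sum>\<^bsub>\<gamma> > 0\<^esub> |res|\<close>: by linear independence no other combination of ordinates in the
  expansion of the product meets a pole. For the lower limit replace \<open>A\<close> by \<open>-A\<close>.
\<close>

section \<open>Laplace transforms\<close>

text \<open>Analytic facts are stated as product identities \<open>laplace A s * Q s = R s\<close>
  with \<open>Q\<close> and \<open>R\<close> entire, so that poles appear as zeros of
  \<open>Q\<close>. Such an identity is checked for large real arguments, where crude bounds on M(u)
  suffice, and the identity theorem carries it further. Only the behaviour near single points of the
  line enters, and each finite set of zeros is treated separately. Since \<open>zeta\<close> is
  introduced by a choice, a continuation has to be constructed; the transform of the fractional part
  of e^t serves for that. Simplicity of the poles comes from positivity: for D - A \<ge> 0 the
  transform at \<delta> + iy is in modulus at most that at \<delta>, which is O(1/\<delta>). Hence a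
  multiple zero is incompatible with a one-sided bound, and the value \<infinity> of
  \<open>zero_term\<close> is consistent with the claim. The condition \<kappa> \<le> 3/2 keeps the
  zero \<kappa> - 1 of w - \<kappa> + 1 from lying to the right of the line Re w = 1/2; for \<kappa>
  = 3/2 it lies on the line and its residue is the constant 2/zeta(1/2). The factor 1/2 in the
  theorem arises because zeros come in conjugate pairs.\<close>

definition laplace :: "(real \<Rightarrow> real) \<Rightarrow> complex \<Rightarrow> complex" where
  "laplace f s = (LINT t:{0..}|lborel. of_real (f t) * exp (- s * of_real t))"

text \<open>Absolute convergence at one real point, the form in which a half-plane of convergence is
  tracked; the Bochner integral in \<open>laplace\<close> returns 0 where integrability
  fails.\<close>

definition laplace_conv :: "(real \<Rightarrow> real) \<Rightarrow> real \<Rightarrow> bool" where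
  "laplace_conv f x \<longleftrightarrow> set_integrable lborel {0..} (\<lambda>t. f t * exp (- x * t))"

text \<open>The factor \<open>exp (- x * t)\<close> never vanishes and can be divided out, which
  recovers measurability of \<open>f\<close> on the half-line from integrability.\<close>

lemma laplace_conv_measurable:
  assumes "laplace_conv f x"
  shows "(\<lambda>t. indicator {0..} t * f t) \<in> borel_measurable borel"
proof -
  have "(\<lambda>t. indicator {0..} t *\<^sub>R (f t * exp (- x * t))) \<in> borel_measurable lborel"
    using assms unfolding laplace_conv_def set_integrable_def by (rule borel_measurable_integrable)
  hence "(\<lambda>t. indicator {0..} t *\<^sub>R (f t * exp (- x * t))) \<in> borel_measurable borel" by simp
  hence "(\<lambda>t. (indicator {0..} t *\<^sub>R (f t * exp (- x * t))) * exp (x * t)) \<in> borel_measurable borel"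
    by measurable
  also have "(\<lambda>t. (indicator {0..} t *\<^sub>R (f t * exp (- x * t))) * exp (x * t)) = (\<lambda>t. indicator {0..} t * f t)"
    by (auto simp: fun_eq_iff mult.assoc exp_add[symmetric])
  finally show ?thesis .
qed

lemma set_integrable_laplace_bound:
  fixes g :: "real \<Rightarrow> 'a :: {real_normed_algebra_1, banach, second_countable_topology}"
  assumes "laplace_conv f x" "g \<in> borel_measurable borel"
    and "\<And>t. t \<ge> 0 \<Longrightarrow> norm (g t) \<le> B * exp (- x * t)"
  shows "set_integrable lborel {0..} (\<lambda>t. of_real (f t) * g t)"
  unfolding set_integrable_def
proof (rule Bochner_Integration.integrable_bound)
  show "integrable lborel (\<lambda>t. B * (indicator {0..} t *\<^sub>R (f t * exp (- x * t))))"
    using assms(1) unfolding laplace_conv_def set_integrable_def by (rule integrable_mult_right)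
  have "(\<lambda>t. of_real (indicator {0..} t * f t) * g t) \<in> borel_measurable borel"
    using laplace_conv_measurable[OF assms(1)] assms(2) by measurable
  also have "(\<lambda>t. of_real (indicator {0..} t * f t) * g t) = (\<lambda>t. indicator {0..} t *\<^sub>R (of_real (f t) * g t))"
    by (auto simp: fun_eq_iff indicator_def)
  finally show "(\<lambda>t. indicator {0..} t *\<^sub>R (of_real (f t) * g t)) \<in> borel_measurable lborel"
    by simp
  have "norm (of_real (f t) * g t) \<le> norm (B * (f t * exp (- x * t)))" if "t \<ge> 0" for t
  proof -
    have "norm (of_real (f t) * g t) \<le> \<bar>f t\<bar> * norm (g t)"
      by (metis norm_mult_ineq norm_of_real)
    also have "\<dots> \<le> \<bar>f t\<bar> * (B * exp (- x * t))"
      by (intro mult_left_mono assms(3) that) auto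
    also have "\<dots> \<le> norm (B * (f t * exp (- x * t)))"
      using mult_right_mono[OF abs_ge_self[of B], of "\<bar>f t\<bar> * exp (- x * t)"]
      by (simp add: abs_mult mult_ac)
    finally show ?thesis .
  qed
  thus "AE t in lborel. norm (indicator {0..} t *\<^sub>R (of_real (f t) * g t))
      \<le> norm (B * (indicator {0..} t *\<^sub>R (f t * exp (- x * t))))"
    by (auto simp: indicator_def)
qed

lemma laplace_conv_mono:
  assumes "laplace_conv f x" "x \<le> y"
  shows "laplace_conv f y"
  using set_integrable_laplace_bound[OF assms(1), of "\<lambda>t. exp (- y * t)" 1] assms(2)
  by (simp add: laplace_conv_def mult_right_mono)

lemma laplace_integrable:
  assumes "laplace_conv f x" "x \<le> Re s"
  shows "set_integrable lborel {0..} (\<lambda>t. complex_of_real (f t) * exp (- s * of_real t))"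
  by (rule set_integrable_laplace_bound[OF assms(1), of _ 1]) (use assms(2) in \<open>auto simp: mult_right_mono\<close>)

lemma power_div_fact_le_exp:
  fixes x :: real assumes "x \<ge> 0" shows "x ^ k / fact k \<le> exp x"
proof -
  have "(\<Sum>i\<in>{k}. x ^ i / fact i) \<le> (\<Sum>i. x ^ i / fact i)"
    using assms summable_exp_generic[of x] by (intro sum_le_suminf) (auto simp: field_simps scaleR_conv_of_real)
  thus ?thesis by (simp add: exp_def field_simps scaleR_conv_of_real)
qed

text \<open>Up to a factor (-1)^k these are the Taylor coefficients of the transform at
  \<open>a\<close>. Expanding in powers of \<open>a - s\<close> keeps them nonnegative for
  nonnegative \<open>f\<close>, which Landau's argument relies on.\<close>

definition laplace_coeff :: "(real \<Rightarrow> real) \<Rightarrow> real \<Rightarrow> nat \<Rightarrow> real" where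
  "laplace_coeff f a k = (LINT t:{0..}|lborel. f t * (t ^ k / fact k * exp (- a * t)))"

text \<open>The distance \<open>h\<close> to a known point of convergence absorbs the power of t,
  because \<open>(h * t) ^ k / fact k \<le> exp (h * t)\<close>.\<close>

lemma laplace_coeff_integrable:
  assumes "laplace_conv f (a - h)" "h > 0"
  shows "set_integrable lborel {0..} (\<lambda>t. f t * (t ^ k / fact k * exp (- a * t)))"
proof -
  have "norm (t ^ k / fact k * exp (- a * t)) \<le> inverse (h ^ k) * exp (- (a - h) * t)" if "t \<ge> 0" for t
  proof -
    have "norm (t ^ k / fact k * exp (- a * t)) = inverse (h ^ k) * ((h * t) ^ k / fact k * exp (- a * t))"
      using assms(2) that by (auto simp: abs_mult field_simps power_mult_distrib)
    also have "\<dots> \<le> inverse (h ^ k) * (exp (h * t) * exp (- a * t))"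
      using assms(2) that power_div_fact_le_exp[of "h * t" k]
      by (intro mult_left_mono mult_right_mono) auto
    also have "exp (h * t) * exp (- a * t) = exp (- (a - h) * t)"
      by (simp add: exp_add[symmetric] algebra_simps)
    finally show ?thesis .
  qed
  from set_integrable_laplace_bound[OF assms(1) _ this] show ?thesis by simp
qed

text \<open>Term-by-term integration of the series of e^(zt) is allowed because the norms sum to
  |f(t)| e^((|z| - a)t), which is at most the integrable |f(t)| e^((h - a)t).\<close>

lemma laplace_power_series:
  assumes "laplace_conv f (a - h)" "h > 0" "norm z \<le> h"
  shows "(\<lambda>k. of_real (laplace_coeff f a k) * z ^ k) sums laplace f (of_real a - z)"
proof -
  define F where "F = (\<lambda>k t. indicator {0..} t *\<^sub>R (of_real (f t * (t ^ k / fact k * exp (- a * t))) * z ^ k))"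
  have int0: "integrable lborel (\<lambda>t. indicator {0..} t *\<^sub>R (f t * (t ^ k / fact k * exp (- a * t))))" for k
    using laplace_coeff_integrable[OF assms(1,2)] unfolding set_integrable_def .
  have F_eq: "F k = (\<lambda>t. of_real (indicator {0..} t *\<^sub>R (f t * (t ^ k / fact k * exp (- a * t)))) * z ^ k)" for k
    by (auto simp: F_def fun_eq_iff indicator_def)
  have int: "integrable lborel (F k)" for k
    unfolding F_eq by (intro integrable_mult_left integrable_of_real int0)
  have bnd: "integrable lborel (\<lambda>t. \<bar>indicator {0..} t *\<^sub>R (f t * exp (- (a - h) * t))\<bar>)" (is "integrable _ ?b")
    using assms(1) unfolding laplace_conv_def set_integrable_def by (rule integrable_abs)
  have sums_t: "(\<lambda>k. norm (F k t)) sums (indicator {0..} t * \<bar>f t\<bar> * exp (- a * t) * exp (norm z * t))" for t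
  proof -
    have "(\<lambda>k. indicator {0..} t * \<bar>f t\<bar> * exp (- a * t) * ((norm z * t) ^ k /\<^sub>R fact k))
        sums (indicator {0..} t * \<bar>f t\<bar> * exp (- a * t) * exp (norm z * t))"
      by (intro sums_mult exp_converges)
    also have "(\<lambda>k. indicator {0..} t * \<bar>f t\<bar> * exp (- a * t) * ((norm z * t) ^ k /\<^sub>R fact k)) = (\<lambda>k. norm (F k t))"
      by (auto simp: F_def fun_eq_iff indicator_def norm_mult norm_inverse norm_power abs_mult power_mult_distrib divide_inverse mult_ac)
    finally show ?thesis .
  qed
  have le_t: "indicator {0..} t * \<bar>f t\<bar> * exp (- a * t) * exp (norm z * t) \<le> ?b t" for t
    using mult_right_mono[OF assms(3), of t]
    by (auto simp: indicator_def abs_mult mult.assoc exp_add[symmetric] algebra_simps intro!: mult_left_mono)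
  have summ: "summable (\<lambda>k. LINT t|lborel. norm (F k t))"
  proof (rule summableI_nonneg_bounded)
    fix n
    have "(\<Sum>k<n. LINT t|lborel. norm (F k t)) = (LINT t|lborel. (\<Sum>k<n. norm (F k t)))"
      using int by (subst Bochner_Integration.integral_sum) auto
    also have "\<dots> \<le> (LINT t|lborel. ?b t)"
    proof (intro integral_mono bnd Bochner_Integration.integrable_sum integrable_norm int)
      fix t
      have "(\<Sum>k<n. norm (F k t)) \<le> (\<Sum>k. norm (F k t))"
        using sums_t[of t] by (intro sum_le_suminf) (auto simp: sums_iff)
      also have "\<dots> \<le> ?b t" using sums_t[of t] le_t[of t] by (simp add: sums_iff)
      finally show "(\<Sum>k<n. norm (F k t)) \<le> ?b t" .
    qed
    finally show "(\<Sum>k<n. LINT t|lborel. norm (F k t)) \<le> (LINT t|lborel. ?b t)" .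
  qed auto
  have *: "(\<lambda>k. integral\<^sup>L lborel (F k)) sums (LINT t|lborel. (\<Sum>k. F k t))"
    using sums_integral[OF int _ summ] sums_t by (auto simp: sums_iff)
  have "integral\<^sup>L lborel (F k) = of_real (laplace_coeff f a k) * z ^ k" for k
    unfolding F_eq laplace_coeff_def set_lebesgue_integral_def
    by (simp add: integral_mult_left_zero flip: integral_complex_of_real)
  moreover have "(\<Sum>k. F k t) = indicator {0..} t *\<^sub>R (of_real (f t) * exp (- (of_real a - z) * of_real t))" for t
  proof -
    have "(\<lambda>k. of_real (indicator {0..} t * f t * exp (- a * t)) * ((z * of_real t) ^ k /\<^sub>R fact k))
        sums (of_real (indicator {0..} t * f t * exp (- a * t)) * exp (z * of_real t))"
      by (intro sums_mult exp_converges)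
    also have "(\<lambda>k. of_real (indicator {0..} t * f t * exp (- a * t)) * ((z * of_real t) ^ k /\<^sub>R fact k)) = (\<lambda>k. F k t)"
      by (auto simp: F_def fun_eq_iff indicator_def power_mult_distrib scaleR_conv_of_real field_simps)
    also have "of_real (indicator {0..} t * f t * exp (- a * t)) * exp (z * of_real t)
       = indicator {0..} t *\<^sub>R (of_real (f t) * exp (- (of_real a - z) * of_real t))"
      by (auto simp: indicator_def exp_of_real[symmetric] mult.assoc exp_add[symmetric] algebra_simps)
    finally show ?thesis by (simp add: sums_iff)
  qed
  ultimately show ?thesis using * by (simp add: laplace_def set_lebesgue_integral_def)
qed

text \<open>Power series in discs centred on the real axis cover the half-plane: such a disc may be
  large, as long as its leftmost point stays to the right of \<open>c\<close>.\<close>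

lemma laplace_holomorphic:
  assumes "\<And>x. x > c \<Longrightarrow> laplace_conv f x"
  shows "laplace f holomorphic_on {s. Re s > c}"
proof -
  have "\<exists>r>0. \<exists>a. s \<in> ball (of_real a) r \<and> laplace f holomorphic_on ball (of_real a) r" if s: "Re s > c" for s
  proof -
    define d where "d = (Re s - c) / 2"
    define x where "x = c + d"
    have d: "d > 0" "x > c" "Re s = x + d" using s by (auto simp: d_def x_def field_simps)
    \<comment> \<open>With this radius |s - a|^2 = (h - d)^2 + (h - d) d = h^2 - h d < h^2, while
      the disc ends at a - h = x > c.\<close>
    define h where "h = (Im s)\<^sup>2 / d + d"
    define a where "a = x + h"
    have h: "h > 0" using d by (auto simp: h_def intro: add_nonneg_pos)
    have "norm (s - of_real a) ^ 2 = (h - d)\<^sup>2 + (Im s)\<^sup>2"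
      by (subst cmod_power2) (simp add: a_def d power2_eq_square algebra_simps)
    also have "(Im s)\<^sup>2 = (h - d) * d" using d by (simp add: h_def)
    also have "(h - d)\<^sup>2 + (h - d) * d = h\<^sup>2 - h * d" by (simp add: power2_eq_square algebra_simps)
    also have "\<dots> < h\<^sup>2" using h d by simp
    finally have "norm (s - of_real a) < h" using h by (simp add: power_less_imp_less_base)
    hence "s \<in> ball (of_real a) h" by (simp add: dist_norm norm_minus_commute)
    moreover have "laplace f holomorphic_on ball (of_real a) h"
    proof (rule power_series_holomorphic)
      fix w :: complex assume w: "w \<in> ball (of_real a) h"
      have "laplace_conv f (a - h)" using d by (auto simp: a_def intro: assms)
      hence "(\<lambda>k. of_real (laplace_coeff f a k) * (of_real a - w) ^ k) sums laplace f w"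
        using laplace_power_series[of f a h "of_real a - w"] h w by (simp add: dist_norm)
      also have "(\<lambda>k. complex_of_real (laplace_coeff f a k) * (of_real a - w) ^ k)
          = (\<lambda>k. of_real (laplace_coeff f a k) * (-1) ^ k * (w - of_real a) ^ k)"
        by (auto simp: fun_eq_iff mult.assoc simp flip: power_mult_distrib)
      finally show "(\<lambda>k. of_real (laplace_coeff f a k) * (-1) ^ k * (w - of_real a) ^ k) sums laplace f w" .
    qed
    ultimately show ?thesis using h by blast
  qed
  thus ?thesis
    by (smt (verit, del_insts) at_within_open field_differentiable_at_within holomorphic_on_def holomorphic_on_imp_differentiable_at mem_Collect_eq open_ball)
qed

text \<open>Converse of the expansion: for nonnegative \<open>f\<close> nothing cancels, so a
  convergent series at distance \<open>r\<close> to the left of \<open>a\<close> forces absolute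
  convergence of the integral there. This is how analyticity turns into convergence.\<close>

lemma laplace_conv_of_summable:
  assumes "laplace_conv f (a - h)" "h > 0" "\<And>t. t \<ge> 0 \<Longrightarrow> f t \<ge> 0"
    and "r \<ge> 0" "summable (\<lambda>k. laplace_coeff f a k * r ^ k)"
  shows "laplace_conv f (a - r)"
proof -
  define F where "F = (\<lambda>k t. (indicator {0..} t *\<^sub>R (f t * (t ^ k / fact k * exp (- a * t)))) * r ^ k)"
  have int: "integrable lborel (F k)" for k
    unfolding F_def using laplace_coeff_integrable[OF assms(1,2)] unfolding set_integrable_def
    by (intro integrable_mult_left)
  have nonneg: "F k t \<ge> 0" for k t using assms(3,4) by (auto simp: F_def indicator_def)
  have sums_t: "(\<lambda>k. F k t) sums (indicator {0..} t *\<^sub>R (f t * exp (- (a - r) * t)))" for t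
  proof -
    have "(\<lambda>k. indicator {0..} t * f t * exp (- a * t) * ((r * t) ^ k /\<^sub>R fact k))
        sums (indicator {0..} t * f t * exp (- a * t) * exp (r * t))"
      by (intro sums_mult exp_converges)
    also have "(\<lambda>k. indicator {0..} t * f t * exp (- a * t) * ((r * t) ^ k /\<^sub>R fact k)) = (\<lambda>k. F k t)"
      by (auto simp: F_def fun_eq_iff indicator_def power_mult_distrib field_simps)
    also have "indicator {0..} t * f t * exp (- a * t) * exp (r * t) = indicator {0..} t *\<^sub>R (f t * exp (- (a - r) * t))"
      by (auto simp: indicator_def mult.assoc exp_add[symmetric] algebra_simps)
    finally show ?thesis .
  qed
  have "(LINT t|lborel. norm (F k t)) = laplace_coeff f a k * r ^ k" for k
  proof -
    have "(LINT t|lborel. norm (F k t)) = integral\<^sup>L lborel (F k)" using nonneg by simp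
    also have "\<dots> = laplace_coeff f a k * r ^ k"
      unfolding F_def laplace_coeff_def set_lebesgue_integral_def by (rule integral_mult_left_zero)
    finally show ?thesis .
  qed
  hence "integrable lborel (\<lambda>t. \<Sum>k. F k t)"
    using assms(5) sums_t nonneg by (intro integrable_suminf int) (auto simp: sums_iff)
  also have "(\<lambda>t. \<Sum>k. F k t) = (\<lambda>t. indicator {0..} t *\<^sub>R (f t * exp (- (a - r) * t)))"
    using sums_t by (auto simp: sums_iff)
  finally show ?thesis by (simp add: laplace_conv_def set_integrable_def)
qed

text \<open>The real points beyond \<open>d\<close> accumulate inside the half-plane, so the
  identity theorem applies. Identities verified only for large real x are extended this way.\<close>

lemma holomorphic_eq_on_halfplane_real:
  assumes "f holomorphic_on {s. Re s > c}" "g holomorphic_on {s. Re s > c}"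
    and "\<And>x. x > d \<Longrightarrow> f (of_real x) = g (of_real x)" "Re s > c"
  shows "f s = g s"
proof -
  define m where "m = max c d"
  have lim: "complex_of_real (m + 1) islimpt of_real ` {m<..}"
    unfolding islimpt_approachable
  proof (intro allI impI)
    fix e :: real assume "e > 0"
    thus "\<exists>x'\<in>of_real ` {m<..}. x' \<noteq> complex_of_real (m + 1) \<and> dist x' (complex_of_real (m + 1)) < e"
      by (intro bexI[of _ "of_real (m + 1 + e / 2)"]) (auto simp: dist_of_real dist_real_def simp del: of_real_add)
  qed
  have "f s - g s = 0"
  proof (rule analytic_continuation[where U = "of_real ` {m<..}" and \<xi> = "of_real (m + 1)" and f = "\<lambda>s. f s - g s"])
    show "(\<lambda>s. f s - g s) holomorphic_on {s. Re s > c}" by (intro holomorphic_intros assms)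
    show "open {s. Re s > c}" by (rule open_halfspace_Re_gt)
    show "connected {s. Re s > c}" by (intro convex_connected convex_halfspace_Re_gt)
  qed (use assms lim in \<open>auto simp: m_def\<close>)
  thus ?thesis by simp
qed

lemma laplace_eq_on_halfplane:
  assumes "\<And>x. x > c \<Longrightarrow> laplace_conv f x"
    and "Q holomorphic_on {s. Re s > c}" "R holomorphic_on {s. Re s > c}"
    and "\<And>x. x > d \<Longrightarrow> laplace f (of_real x) * Q (of_real x) = R (of_real x)" "Re s > c"
  shows "laplace f s * Q s = R s"
  by (rule holomorphic_eq_on_halfplane_real[where f = "\<lambda>s. laplace f s * Q s" and d = d])
     (use assms in \<open>auto intro!: holomorphic_intros laplace_holomorphic\<close>)

text \<open>Landau's theorem on Dirichlet integrals: at the abscissa of convergence of a nonnegative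
  function the transform has no holomorphic continuation, because its Taylor series at a nearby
  point on the right has coefficients of one sign up to the factor \<open>(-1)^k\<close>.\<close>

theorem laplace_conv_landau:
  assumes nonneg: "\<And>t. t \<ge> 0 \<Longrightarrow> f t \<ge> 0" and conv: "laplace_conv f c"
    and Q: "Q holomorphic_on UNIV" and R: "R holomorphic_on UNIV"
    and eq: "\<And>x. x > d \<Longrightarrow> laplace f (of_real x) * Q (of_real x) = R (of_real x)"
    and nz: "\<And>x. x > 0 \<Longrightarrow> Q (of_real x) \<noteq> 0" and "y > 0"
  shows "laplace_conv f y"
proof (rule ccontr)
  assume not: "\<not> laplace_conv f y"
  define X where "X = {x. laplace_conv f x}"
  define \<sigma> where "\<sigma> = Inf X"
  have yX: "y \<le> x" if "x \<in> X" for x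
    using laplace_conv_mono[of f x y] not that by (force simp: X_def)
  have X: "X \<noteq> {}" "bdd_below X" using conv yX by (auto simp: X_def bdd_below_def)
  have "\<sigma> \<ge> y" unfolding \<sigma>_def by (rule cInf_greatest) (use X yX in auto)
  have conv': "laplace_conv f x" if x: "x > \<sigma>" for x
  proof -
    obtain x' where "x' \<in> X" "x' < x" using cInf_lessD[of X x] x X unfolding \<sigma>_def by blast
    thus ?thesis using laplace_conv_mono[of f x' x] by (simp add: X_def)
  qed
  have "isCont Q (of_real \<sigma>)"
    using Q by (auto intro: holomorphic_on_imp_continuous_on continuous_on_interior)
  moreover have "Q (of_real \<sigma>) \<noteq> 0" using \<open>\<sigma> \<ge> y\<close> \<open>y > 0\<close> by (intro nz) auto
  ultimately obtain e' where e': "e' > 0" "\<And>s. dist s (of_real \<sigma>) < e' \<Longrightarrow> Q s \<noteq> 0"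
    using continuous_at_avoid[of "of_real \<sigma>" Q 0] by (metis dist_commute)
  define e where "e = e' / 2"
  have e: "e > 0" "\<And>s. dist s (of_real \<sigma>) < 2 * e \<Longrightarrow> Q s \<noteq> 0" using e' by (auto simp: e_def)
  define F where "F = (\<lambda>s. R s / Q s)"
  \<comment> \<open>The centre lies slightly to the right of \<sigma>, so the disc of radius e
    around it reaches e/2 beyond \<sigma> to the left, yet stays within distance 2e of \<sigma>,
    where \<open>Q\<close> has no zero.\<close>
  define a where "a = \<sigma> + e / 2"
  have "ball (complex_of_real a) e \<subseteq> ball (of_real \<sigma>) (2 * e)"
  proof
    fix s assume "s \<in> ball (complex_of_real a) e"
    moreover have "dist (complex_of_real a) (of_real \<sigma>) = e / 2" using e by (simp add: a_def dist_norm)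
    ultimately show "s \<in> ball (of_real \<sigma>) (2 * e)"
      using dist_triangle[of "of_real \<sigma>" s "of_real a"] e by (simp add: dist_commute)
  qed
  hence Qnz: "Q s \<noteq> 0" if "s \<in> ball (of_real a) e" for s
    using that e(2)[of s] by (auto simp: dist_commute)
  have holF: "F holomorphic_on ball (of_real a) e"
    unfolding F_def by (intro holomorphic_intros holomorphic_on_subset[OF Q] holomorphic_on_subset[OF R] Qnz) auto
  have conva: "laplace_conv f (a - e / 4)" using e by (intro conv') (auto simp: a_def)
  define c where "c = (\<lambda>k. (deriv ^^ k) F (of_real a) / fact k)"
  have F_sums: "(\<lambda>k. c k * u ^ k) sums F (of_real a + u)" if "norm u < e" for u
    using holomorphic_power_series[OF holF, of "of_real a + u"] that by (simp add: c_def dist_norm)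
  have L_sums: "(\<lambda>k. (of_real (laplace_coeff f a k) * (-1) ^ k) * u ^ k) sums F (of_real a + u)"
    if "norm u < e / 4" for u
  proof -
    have "Re (of_real a + u) > \<sigma>" using that e abs_Re_le_cmod[of u] by (simp add: a_def)
    hence "laplace f (of_real a + u) * Q (of_real a + u) = R (of_real a + u)"
      by (rule laplace_eq_on_halfplane[where c = \<sigma> and d = d, rotated -1])
         (auto intro!: conv' holomorphic_on_subset[OF Q] holomorphic_on_subset[OF R] eq)
    moreover have "Q (of_real a + u) \<noteq> 0"
      using that e by (intro Qnz) (simp add: dist_norm)
    ultimately have "laplace f (of_real a - (- u)) = F (of_real a + u)" by (simp add: F_def field_simps)
    moreover have "(\<lambda>k. of_real (laplace_coeff f a k) * (- u) ^ k) sums laplace f (of_real a - (- u))"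
      by (rule laplace_power_series[OF conva]) (use e that in auto)
    moreover have "(- u) ^ k = (-1) ^ k * u ^ k" for k by (metis power_minus)
    ultimately show ?thesis by (simp add: mult.assoc)
  qed
  \<comment> \<open>Two expansions of \<open>F\<close> at \<open>a\<close>: the Taylor series, valid
    in radius e by holomorphy, and the integral expansion, known only in radius e/4. Equal
    coefficients make the second converge in the larger disc as well.\<close>
  have "(\<lambda>u. F (of_real a + u)) has_fps_expansion Abs_fps c"
    by (rule has_fps_expansionI) (use F_sums e in \<open>auto simp: eventually_nhds_metric dist_norm intro!: exI[of _ e]\<close>)
  moreover have "(\<lambda>u. F (of_real a + u)) has_fps_expansion Abs_fps (\<lambda>k. of_real (laplace_coeff f a k) * (-1) ^ k)"
    by (rule has_fps_expansionI) (use L_sums e in \<open>auto simp: eventually_nhds_metric dist_norm intro!: exI[of _ "e / 4"]\<close>)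
  ultimately have "c k = of_real (laplace_coeff f a k) * (-1) ^ k" for k
    using fps_expansion_unique_complex by (metis fps_nth_Abs_fps)
  \<comment> \<open>At -3e/4 the signs (-1)^k cancel, and the point a - 3e/4 = \<sigma> - e/4 lies
    to the left of the supposed abscissa.\<close>
  hence "(\<lambda>k. of_real (laplace_coeff f a k) * (-1) ^ k * (- of_real (3 / 4 * e)) ^ k) sums F (of_real a + (- of_real (3 / 4 * e)))"
    using F_sums[of "- of_real (3 / 4 * e)"] e by (simp del: of_real_mult of_real_divide)
  also have "(\<lambda>k. complex_of_real (laplace_coeff f a k) * (-1) ^ k * (- of_real (3 / 4 * e)) ^ k)
     = (\<lambda>k. of_real (laplace_coeff f a k * (3 / 4 * e) ^ k))"
    by (simp only: mult.assoc power_mult_distrib[symmetric]) (simp add: fun_eq_iff)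
  finally have "summable (\<lambda>k. laplace_coeff f a k * (3 / 4 * e) ^ k)"
    using sums_summable by (metis summable_complex_of_real)
  hence "laplace_conv f (a - 3 / 4 * e)"
    by (intro laplace_conv_of_summable[OF conva]) (use e nonneg in auto)
  hence "\<sigma> \<le> a - 3 / 4 * e" unfolding \<sigma>_def by (intro cInf_lower) (use X in \<open>auto simp: X_def\<close>)
  thus False using e by (simp add: a_def)
qed

text \<open>Integration by parts on [0,b], then b to infinity. The locally finite set
  \<open>S\<close> of exceptional points admits derivatives that jump at t = ln n, as they do for
  integrals of step functions and of functions of the fractional part.\<close>

lemma laplace_derivative:
  assumes cont: "continuous_on {0..} F" and F0: "F 0 = 0"
    and fin: "\<And>b. finite (S \<inter> {0..b})"
    and der: "\<And>t. t > 0 \<Longrightarrow> t \<notin> S \<Longrightarrow> (F has_real_derivative f t) (at t)"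
    and f: "laplace_conv f x" and F: "laplace_conv F x"
    and lim: "((\<lambda>t. F t * exp (- x * t)) \<longlongrightarrow> 0) at_top" and s: "Re s \<ge> x"
  shows "laplace f s = s * laplace F s"
proof -
  define G where "G = (\<lambda>t. of_real (F t) * exp (- s * of_real t))"
  define g where "g = (\<lambda>t. of_real (f t) * exp (- s * of_real t) - s * (of_real (F t) * exp (- s * of_real t)))"
  have int: "set_integrable lborel {0..} g"
    unfolding g_def
    by (intro set_integral_diff(1) laplace_integrable[OF f s] set_integrable_mult_right laplace_integrable[OF F s])
  have val: "(LINT t:{0..}|lborel. g t) = laplace f s - s * laplace F s"
    unfolding g_def laplace_def
    by (subst set_integral_diff(2)[OF laplace_integrable[OF f s] set_integrable_mult_right[OF laplace_integrable[OF F s]]])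
       simp
  have fin_int: "(LINT t:{0..b}|lborel. g t) = G b" if "b \<ge> 0" for b
  proof -
    have "(g has_integral (G b - G 0)) {0..b}"
    proof (rule fundamental_theorem_of_calculus_strong[of "insert 0 (S \<inter> {0..b})"])
      fix t assume t: "t \<in> {0..b} - insert 0 (S \<inter> {0..b})"
      have "(F has_real_derivative f t) (at t)" using t by (intro der) auto
      hence "((\<lambda>t. complex_of_real (F t)) has_vector_derivative of_real (f t)) (at t)"
        by (rule has_vector_derivative_of_real)
      moreover have "((\<lambda>t. exp (- s * of_real t)) has_vector_derivative (- s * exp (- s * of_real t))) (at t)"
        by (rule has_vector_derivative_real_field) (auto intro!: derivative_eq_intros)
      ultimately show "(G has_vector_derivative g t) (at t)"
        unfolding G_def g_def by (rule has_vector_derivative_mult[THEN has_vector_derivative_eq_rhs]) (simp add: algebra_simps)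
    qed (use fin that in \<open>auto simp: G_def intro!: continuous_intros continuous_on_subset[OF cont]\<close>)
    moreover have "set_integrable lborel {0..b} g" by (rule set_integrable_subset[OF int]) auto
    ultimately show ?thesis
      using set_borel_integral_eq_integral(2)[of "{0..b}" g] by (simp add: G_def F0 integral_unique)
  qed
  have "((\<lambda>b. LINT t:{0..b}|lborel. g t) \<longlongrightarrow> (LINT t:{0..}|lborel. g t)) at_top"
    by (rule tendsto_set_lebesgue_integral_at_top) (auto intro: int)
  moreover have "((\<lambda>b. LINT t:{0..b}|lborel. g t) \<longlongrightarrow> 0) at_top"
  proof (rule Lim_null_comparison)
    show "((\<lambda>t. \<bar>F t * exp (- x * t)\<bar>) \<longlongrightarrow> 0) at_top" using lim by (rule tendsto_rabs_zero)
    show "\<forall>\<^sub>F b in at_top. norm (LINT t:{0..b}|lborel. g t) \<le> \<bar>F b * exp (- x * b)\<bar>"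
      using eventually_ge_at_top[of 0]
    proof eventually_elim
      case (elim b)
      thus ?case using s
        by (simp add: fin_int G_def norm_mult abs_mult mult_left_mono mult_right_mono)
    qed
  qed
  ultimately have "(LINT t:{0..}|lborel. g t) = 0" by (rule tendsto_unique[OF trivial_limit_at_top_linorder])
  thus ?thesis using val by simp
qed

section \<open>Elementary transforms and calculation rules\<close>

lemma exp_minus_tendsto_0:
  fixes x :: real assumes "x > 0"
  shows "((\<lambda>t. exp (- x * t)) \<longlongrightarrow> 0) at_top"
proof -
  have "LIM t at_top. x * t :> at_top"
    using assms by (intro filterlim_tendsto_pos_mult_at_top[OF tendsto_const] filterlim_ident)
  hence "LIM t at_top. - x * t :> at_bot" by (simp add: filterlim_uminus_at_bot)
  thus ?thesis by (rule filterlim_compose[OF exp_at_bot])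
qed

lemma exp_indicator_integrable:
  fixes x a :: real assumes "x > 0"
  shows "integrable lborel (\<lambda>t. indicator {a..} t * exp (- x * t))"
    and "(LINT t|lborel. indicator {a..} t * exp (- x * t)) = exp (- x * a) / x"
proof -
  have lim: "((\<lambda>t. - exp (- x * t) / x) \<longlongrightarrow> - 0 / x) at_top"
    using assms by (intro tendsto_intros exp_minus_tendsto_0) auto
  have *: "(\<integral>\<^sup>+t. ennreal (exp (- x * t)) * indicator {a..} t \<partial>lborel) = ennreal (- 0 / x - (- exp (- x * a) / x))"
    by (rule nn_integral_FTC_atLeast[OF _ _ _ lim]) (use assms in \<open>auto intro!: derivative_eq_intros\<close>)
  have **: "(\<integral>\<^sup>+t. ennreal (indicator {a..} t * exp (- x * t)) \<partial>lborel) = ennreal (exp (- x * a) / x)"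
  proof -
    have "(\<integral>\<^sup>+t. ennreal (indicator {a..} t * exp (- x * t)) \<partial>lborel) = (\<integral>\<^sup>+t. ennreal (exp (- x * t)) * indicator {a..} t \<partial>lborel)"
      by (intro nn_integral_cong) (auto simp: indicator_def)
    also note *
    finally show ?thesis by simp
  qed
  show "integrable lborel (\<lambda>t. indicator {a..} t * exp (- x * t))"
    by (rule integrableI_nonneg) (use ** in auto)
  show "(LINT t|lborel. indicator {a..} t * exp (- x * t)) = exp (- x * a) / x"
    using ** assms by (intro integral_eq_nn_integral[THEN trans]) auto
qed

lemma laplace_conv_1: "x > 0 \<Longrightarrow> laplace_conv (\<lambda>_. 1) x"
  using exp_indicator_integrable(1)[of x 0] by (simp add: laplace_conv_def set_integrable_def)

lemma laplace_conv_bounded: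
  assumes "g \<in> borel_measurable borel" "\<And>t. t \<ge> 0 \<Longrightarrow> \<bar>g t\<bar> \<le> B * exp (c * t)" "x > c"
  shows "laplace_conv g x"
proof -
  have "norm (g t * exp (- x * t)) \<le> B * exp (- (x - c) * t)" if "t \<ge> 0" for t
  proof -
    have "norm (g t * exp (- x * t)) \<le> B * exp (c * t) * exp (- x * t)"
      using assms(2)[OF that] by (simp add: abs_mult mult_right_mono)
    also have "\<dots> = B * exp (- (x - c) * t)" by (simp add: mult.assoc exp_add[symmetric] algebra_simps)
    finally show ?thesis .
  qed
  from set_integrable_laplace_bound[OF laplace_conv_1 _ this] assms show ?thesis
    by (simp add: laplace_conv_def)
qed

lemma laplace_exp_mult: "laplace (\<lambda>t. exp (a * t) * f t) s = laplace f (s - of_real a)"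
proof -
  have "of_real (exp (a * t) * f t) * exp (- s * of_real t) = of_real (f t) * exp (- (s - of_real a) * of_real t)" for t
  proof -
    have "of_real (exp (a * t) * f t) * exp (- s * of_real t)
        = of_real (f t) * (exp (complex_of_real (a * t)) * exp (- s * of_real t))"
      by (simp only: exp_of_real) simp
    also have "exp (complex_of_real (a * t)) * exp (- s * of_real t) = exp (- (s - of_real a) * of_real t)"
      by (simp add: exp_add[symmetric] algebra_simps)
    finally show ?thesis .
  qed
  thus ?thesis by (simp only: laplace_def)
qed

lemma laplace_conv_exp_mult:
  assumes "laplace_conv f (x - a)" shows "laplace_conv (\<lambda>t. exp (a * t) * f t) x"
proof -
  have "(\<lambda>t. f t * exp (- (x - a) * t)) = (\<lambda>t. exp (a * t) * f t * exp (- x * t))"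
    by (simp add: mult.assoc mult.left_commute[of _ "f _"] exp_add[symmetric] algebra_simps)
  with assms show ?thesis by (simp only: laplace_conv_def)
qed

lemma laplace_diff:
  assumes "laplace_conv f (Re s)" "laplace_conv g (Re s)"
  shows "laplace (\<lambda>t. f t - g t) s = laplace f s - laplace g s"
  unfolding laplace_def
  by (subst set_integral_diff(2)[symmetric, OF laplace_integrable[OF assms(1) order.refl]
        laplace_integrable[OF assms(2) order.refl]]) (simp add: left_diff_distrib)

lemma laplace_conv_diff:
  assumes "laplace_conv f x" "laplace_conv g x"
  shows "laplace_conv (\<lambda>t. f t - g t) x"
  using assms set_integral_diff(1) unfolding laplace_conv_def by (fastforce simp: algebra_simps)

lemma laplace_cmult: "laplace (\<lambda>t. c * f t) s = of_real c * laplace f s"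
  unfolding laplace_def by (simp add: mult.assoc flip: set_integral_mult_right)

lemma laplace_conv_cmult:
  assumes "laplace_conv f x"
  shows "laplace_conv (\<lambda>t. c * f t) x"
  using assms unfolding laplace_conv_def by (simp add: mult.assoc)

lemma laplace_of_real:
  "laplace f (of_real x) = of_real (LINT t:{0..}|lborel. f t * exp (- x * t))"
proof -
  have "laplace f (of_real x) = (LINT t|lborel. of_real (indicator {0..} t *\<^sub>R (f t * exp (- x * t))))"
    unfolding laplace_def set_lebesgue_integral_def
    by (intro Bochner_Integration.integral_cong) (auto simp: exp_of_real[symmetric] scaleR_conv_of_real)
  thus ?thesis by (simp add: set_lebesgue_integral_def flip: integral_complex_of_real)
qed

text \<open>For real s this is the integral of an exponential; after multiplication by s both sides
  are holomorphic, which gives complex s.\<close>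

lemma laplace_indicator:
  assumes "a \<ge> 0" "Re s > 0"
  shows "laplace (indicator {a..}) s = exp (- s * of_real a) / s"
proof -
  have eq: "indicat_real {0..} t *\<^sub>R (indicator {a..} t * exp (- x * t)) = indicator {a..} t * exp (- x * t)" for t x
    using assms(1) by (auto simp: indicator_def)
  have conv: "laplace_conv (indicator {a..}) x" if "x > 0" for x
    using exp_indicator_integrable(1)[OF that, of a] by (simp only: laplace_conv_def set_integrable_def eq)
  have "laplace (indicator {a..}) s * s = exp (- s * of_real a)"
  proof (rule laplace_eq_on_halfplane[where c = 0 and d = 0, OF conv])
    fix x :: real assume "x > 0"
    thus "laplace (indicator {a..}) (of_real x) * of_real x = exp (- of_real x * of_real a)"
      using exp_indicator_integrable(2)[of x a]
      by (simp only: laplace_of_real set_lebesgue_integral_def eq) (simp add: exp_of_real[symmetric])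
  qed (use assms in \<open>auto intro!: holomorphic_intros\<close>)
  moreover have "s \<noteq> 0" using assms(2) by auto
  ultimately show ?thesis by (simp add: nonzero_eq_divide_eq)
qed

lemma laplace_1: "Re s > 0 \<Longrightarrow> laplace (\<lambda>_. 1) s = 1 / s"
proof -
  have "laplace (\<lambda>_. 1) s = laplace (indicator {0..}) s"
    unfolding laplace_def by (intro set_lebesgue_integral_cong) auto
  thus "Re s > 0 \<Longrightarrow> laplace (\<lambda>_. 1) s = 1 / s" by (simp add: laplace_indicator)
qed

section \<open>Dirichlet series as transforms of summatory functions\<close>

lemma finite_nat_le_real: "finite {n. 1 \<le> n \<and> real n \<le> x}"
proof (rule finite_subset)
  show "{n. 1 \<le> n \<and> real n \<le> x} \<subseteq> {..nat \<lceil>x\<rceil>}" by (auto simp: le_nat_iff) linarith+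
qed auto

text \<open>Abel summation as a transform: the step function is a superposition of jumps c(n) at t =
  ln n, and each jump contributes c(n) n^(-s) / s. Integral and sum may be exchanged because the sum
  of n^(-Re s) converges.\<close>

lemma laplace_partial_sums:
  fixes c :: "nat \<Rightarrow> real" and s :: complex
  defines "S \<equiv> (\<lambda>t. \<Sum>n | 1 \<le> n \<and> real n \<le> exp t. c n)"
  assumes c: "\<And>n. \<bar>c n\<bar> \<le> 1" and s: "Re s > 1"
  shows "laplace_conv S (Re s)"
    and "(\<lambda>n. of_real (c (Suc n)) / of_nat (Suc n) powr s) sums (s * laplace S s)"
proof -
  have main: "integrable lborel (\<lambda>t. indicator {0..} t *\<^sub>R (of_real (S t) * exp (- s * of_real t)))"
      "(\<lambda>n. of_real (c (Suc n)) / of_nat (Suc n) powr s / s) sums laplace S s"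
    if s: "Re s > 1" for s
  proof -
    define F where "F = (\<lambda>n t. indicator {0..} t *\<^sub>R (of_real (c (Suc n)) * (of_real (indicator {ln (real (Suc n))..} t) * exp (- s * of_real t))))"
    have conv: "laplace_conv (indicator {a..}) x" if "a \<ge> 0" "x > 0" for a x :: real
      by (rule laplace_conv_bounded[of _ 1 0]) (use that in auto)
    have int: "integrable lborel (F n)" for n
    proof -
      have "laplace_conv (indicator {ln (real (Suc n))..}) 1" by (rule conv) auto
      from set_integrable_mult_right[OF laplace_integrable[OF this, of s], of "of_real (c (Suc n))"]
      show ?thesis using s by (simp add: F_def set_integrable_def del: of_nat_Suc)
    qed
    have F_int: "integral\<^sup>L lborel (F n) = of_real (c (Suc n)) / of_nat (Suc n) powr s / s" for n
    proof -
      have "integral\<^sup>L lborel (F n) = of_real (c (Suc n)) * laplace (indicator {ln (real (Suc n))..}) s"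
      proof -
        have "F n = (\<lambda>t. of_real (c (Suc n)) * (indicator {0..} t *\<^sub>R
            (of_real (indicator {ln (real (Suc n))..} t) * exp (- s * of_real t))))"
          by (auto simp: F_def fun_eq_iff indicator_def)
        thus ?thesis
          by (simp only: laplace_def set_lebesgue_integral_def) (rule integral_mult_right_zero)
      qed
      also have "laplace (indicator {ln (real (Suc n))..}) s = exp (- s * of_real (ln (real (Suc n)))) / s"
        using s by (intro laplace_indicator) auto
      also have "exp (- s * of_real (ln (real (Suc n)))) = 1 / of_nat (Suc n) powr s"
        by (subst powr_def) (auto simp: exp_minus field_simps Ln_of_nat simp del: of_nat_Suc)
      finally show ?thesis by simp
    qed
    have ln_Suc_nonneg: "ln (real (Suc n)) \<ge> 0" for n by (rule ln_ge_zero) simp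
    have F_norm: "(LINT t|lborel. norm (F n t)) = \<bar>c (Suc n)\<bar> * (real (Suc n) powr (- Re s) / Re s)" for n
    proof -
      have "(LINT t|lborel. norm (F n t)) = (LINT t|lborel. \<bar>c (Suc n)\<bar> * (indicator {ln (real (Suc n))..} t * exp (- Re s * t)))"
        by (intro Bochner_Integration.integral_cong)
           (auto simp: F_def indicator_def norm_mult simp del: of_nat_Suc dest: order_trans[OF ln_Suc_nonneg])
      also have "\<dots> = \<bar>c (Suc n)\<bar> * (exp (- Re s * ln (real (Suc n))) / Re s)"
        using s by (subst integral_mult_right_zero, subst exp_indicator_integrable) auto
      finally show ?thesis by (simp add: powr_def)
    qed
    have "summable (\<lambda>n. real (Suc n) powr (- Re s))"
      using s by (subst summable_Suc_iff[of "\<lambda>n. real n powr (- Re s)"]) (simp add: summable_real_powr_iff)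
    hence "summable (\<lambda>n. real (Suc n) powr (- Re s) / Re s)" by (rule summable_divide)
    hence summ: "summable (\<lambda>n. LINT t|lborel. norm (F n t))"
      by (rule summable_comparison_test'[of _ 0])
         (use s c in \<open>auto simp: F_norm abs_mult simp del: of_nat_Suc intro!: mult_left_le_one_le divide_right_mono\<close>)
    have fin: "finite {n. real (Suc n) \<le> exp t}" for t
      using finite_vimageI[OF finite_nat_le_real[of "exp t"], of Suc] by (simp add: vimage_def)
    have zero: "F n t = 0" if "n \<notin> {n. real (Suc n) \<le> exp t}" for n t
      using that by (auto simp: F_def indicator_def ln_ge_iff simp del: of_nat_Suc) (metis exp_le_cancel_iff exp_ln of_nat_0_less_iff zero_less_Suc)
    have sumF: "(\<lambda>n. F n t) sums (indicator {0..} t *\<^sub>R (of_real (S t) * exp (- s * of_real t)))" for t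
    proof -
      have "(\<Sum>n | real (Suc n) \<le> exp t. F n t) = (\<Sum>n | real (Suc n) \<le> exp t. indicator {0..} t *\<^sub>R (of_real (c (Suc n)) * exp (- s * of_real t)))"
      proof (intro sum.cong refl)
        fix n assume "n \<in> {n. real (Suc n) \<le> exp t}"
        hence "ln (real (Suc n)) \<le> t" by (metis exp_le_cancel_iff exp_ln mem_Collect_eq of_nat_0_less_iff zero_less_Suc)
        thus "F n t = indicator {0..} t *\<^sub>R (of_real (c (Suc n)) * exp (- s * of_real t))"
          by (simp add: F_def)
      qed
      also have "\<dots> = indicator {0..} t *\<^sub>R (of_real (\<Sum>n | real (Suc n) \<le> exp t. c (Suc n)) * exp (- s * of_real t))"
        by (simp add: sum_distrib_right scaleR_sum_right)
      also have "(\<Sum>n | real (Suc n) \<le> exp t. c (Suc n)) = S t"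
        unfolding S_def by (rule sum.reindex_bij_witness[of _ "\<lambda>n. n - 1" Suc]) auto
      finally show ?thesis using sums_finite[of "{n. real (Suc n) \<le> exp t}" "\<lambda>n. F n t"] fin zero by simp
    qed
    have ae: "AE t in lborel. summable (\<lambda>n. norm (F n t))"
      by (intro AE_I2 summable_finite[OF fin]) (use zero in auto)
    show "integrable lborel (\<lambda>t. indicator {0..} t *\<^sub>R (of_real (S t) * exp (- s * of_real t)))"
      using integrable_suminf[OF int ae summ] sumF by (simp add: sums_iff)
    show "(\<lambda>n. of_real (c (Suc n)) / of_nat (Suc n) powr s / s) sums laplace S s"
      using sums_integral[OF int ae summ] sumF by (simp add: sums_iff F_int laplace_def set_lebesgue_integral_def)
  qed
  have "integrable lborel (\<lambda>t. Re (indicator {0..} t *\<^sub>R (of_real (S t) * exp (- of_real (Re s) * of_real t))))"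
    using s by (intro integrable_Re main) auto
  also have "(\<lambda>t. Re (indicator {0..} t *\<^sub>R (of_real (S t) * exp (- of_real (Re s) * of_real t))))
     = (\<lambda>t. indicator {0..} t *\<^sub>R (S t * exp (- Re s * t)))"
    by (auto simp: fun_eq_iff Re_exp)
  finally show "laplace_conv S (Re s)" by (simp add: laplace_conv_def set_integrable_def)
  show "(\<lambda>n. of_real (c (Suc n)) / of_nat (Suc n) powr s) sums (s * laplace S s)"
  proof -
    have "s \<noteq> 0" using s by auto
    thus ?thesis using sums_mult[OF main(2)[OF s], of s] by simp
  qed
qed

section \<open>Analytic continuation of the zeta function\<close>

text \<open>All polynomials are taken at once because integration by parts replaces q by an
  antiderivative of q minus its mean.\<close>

definition frac_poly :: "real poly \<Rightarrow> real \<Rightarrow> real" where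
  "frac_poly q t = poly q (frac (exp t))"

lemma frac_poly_bounded: "\<exists>B. \<forall>t. \<bar>frac_poly q t\<bar> \<le> B"
proof -
  have "compact (poly q ` {0..1})"
    by (intro compact_continuous_image) (auto intro!: continuous_intros)
  then obtain B where "\<forall>x\<in>poly q ` {0..1}. norm x \<le> B"
    using compact_imp_bounded bounded_iff by blast
  moreover have "frac (exp t) \<in> {0..1}" for t :: real using frac_lt_1[of "exp t"] by auto
  ultimately show ?thesis by (auto simp: frac_poly_def intro!: exI[of _ B])
qed

lemma frac_poly_measurable [measurable]: "frac_poly q \<in> borel_measurable borel"
proof -
  have 1: "poly q \<in> borel_measurable borel"
    by (intro borel_measurable_continuous_onI continuous_intros)
  have 2: "(\<lambda>t::real. frac (exp t)) \<in> borel_measurable borel" unfolding frac_def by measurable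
  show ?thesis using measurable_compose[OF 2 1] by (simp add: frac_poly_def[abs_def])
qed

lemma frac_poly_conv: "x > 0 \<Longrightarrow> laplace_conv (frac_poly q) x"
proof -
  obtain B where "\<And>t. \<bar>frac_poly q t\<bar> \<le> B" using frac_poly_bounded by metis
  thus "x > 0 \<Longrightarrow> laplace_conv (frac_poly q) x"
    by (intro laplace_conv_bounded[where c = 0 and B = B]) auto
qed

lemma poly_antiderivative_exists:
  fixes q :: "'a :: {field_char_0} poly"
  shows "\<exists>P. pderiv P = q"
proof (intro exI)
  define P where "P = (\<Sum>i\<le>degree q. monom (coeff q i / of_nat (Suc i)) (Suc i))"
  have sum: "pderiv (sum f A) = (\<Sum>i\<in>A. pderiv (f i))" for f :: "nat \<Rightarrow> 'a poly" and A
    by (induction A rule: infinite_finite_induct) (auto simp: pderiv_add)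
  have "pderiv P = (\<Sum>i\<le>degree q. monom (coeff q i) i)"
    unfolding P_def sum by (intro sum.cong) (auto simp: pderiv_monom simp del: of_nat_Suc)
  thus "pderiv P = q" by (simp add: poly_as_sum_of_monoms)
qed

text \<open>Equal values at 0 and 1 close the only possible jumps, those at integers; there the two
  adjacent unit intervals are glued.\<close>

lemma poly_frac_continuous:
  fixes p :: "real poly" assumes "poly p 0 = poly p 1"
  shows "isCont (\<lambda>x. poly p (frac x)) x"
proof (cases "x \<in> \<int>")
  case False
  thus ?thesis by (intro continuous_intros continuous_frac)
next
  case True
  then obtain n where n: "x = of_int n" by (auto elim: Ints_cases)
  have cont: "continuous_on {of_int k..of_int k + 1} (\<lambda>x. poly p (frac x))" for k :: int
  proof -
    have "poly p (y - of_int k) = poly p (frac y)" if y: "y \<in> {of_int k..of_int k + 1}" for y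
    proof (cases "y = of_int k + 1")
      case True
      thus ?thesis using assms by (simp add: frac_def)
    next
      case False
      hence "\<lfloor>y\<rfloor> = k" using y by (intro floor_unique) auto
      thus ?thesis by (simp add: frac_def)
    qed
    moreover have "continuous_on {of_int k..of_int k + 1} (\<lambda>y. poly p (y - of_int k))"
      by (intro continuous_intros)
    ultimately show ?thesis by (metis (no_types, lifting) continuous_on_cong)
  qed
  have "continuous_on ({of_int (n - 1)..of_int (n - 1) + 1} \<union> {of_int n..of_int n + 1}) (\<lambda>x. poly p (frac x))"
    by (intro continuous_on_closed_Un cont) auto
  hence "continuous_on {of_int n - 1<..<of_int n + 1} (\<lambda>x. poly p (frac x))"
    by (rule continuous_on_subset) auto
  thus ?thesis by (rule continuous_on_interior) (auto simp: n interior_open)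
qed

lemma finite_exp_Ints: "finite ({t. exp t \<in> (\<int> :: real set)} \<inter> {0..b})"
proof (rule finite_subset)
  show "{t. exp t \<in> (\<int> :: real set)} \<inter> {0..b} \<subseteq> (\<lambda>n. ln (real n)) ` {n. 1 \<le> n \<and> real n \<le> exp b}"
  proof
    fix t :: real assume t: "t \<in> {t. exp t \<in> \<int>} \<inter> {0..b}"
    then obtain k where k: "exp t = of_int k" by (auto elim: Ints_cases)
    hence "of_int k \<ge> (1 :: real)" using t by (metis Int_iff atLeastAtMost_iff one_le_exp_iff)
    hence k1: "k \<ge> 1" by linarith
    hence "exp t = real (nat k)" using k by simp
    moreover from this have "t = ln (real (nat k))" by (metis ln_exp)
    moreover have "exp t \<le> exp b" using t by simp
    ultimately show "t \<in> (\<lambda>n. ln (real n)) ` {n. 1 \<le> n \<and> real n \<le> exp b}"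
      using k1 by (intro image_eqI[of _ _ "nat k"]) auto
  qed
qed (intro finite_imageI finite_nat_le_real)

text \<open>Integration by parts against a periodic function of mean zero; iterating it continues the
  transform across the plane, one unit strip at a time (Euler--Maclaurin).\<close>

lemma frac_poly_shift:
  "\<exists>p c. \<forall>s. Re s > 0 \<longrightarrow> laplace (frac_poly q) s = of_real c / s + (s + 1) * laplace (frac_poly p) (s + 1)"
proof -
  obtain P where P: "pderiv P = q" using poly_antiderivative_exists by blast
  define c where "c = poly P 1 - poly P 0"
  \<comment> \<open>Subtracting the linear interpolation makes \<open>p\<close> vanish at both ends
    of the period, so \<open>frac_poly p\<close> is continuous and equals 0 at t = 0, where e^t = 1.
    The slope \<open>c\<close> is the mean of \<open>q\<close> over a period, the part that yields
    the pole at 0.\<close>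
  define p where "p = P - [:poly P 0, c:]"
  have p01: "poly p 0 = 0" "poly p 1 = 0" by (simp_all add: p_def c_def)
  have pd: "pderiv p = q - [:c:]" by (simp add: p_def pderiv_diff P pderiv_pCons)
  show ?thesis
  proof (intro exI[of _ p] exI[of _ c] allI impI)
    fix s :: complex assume s: "Re s > 0"
    define f where "f = (\<lambda>t. exp (1 * t) * (frac_poly q t - c))"
    have qc: "laplace_conv (\<lambda>t. frac_poly q t - c) x" if "x > 0" for x
      using laplace_conv_diff[OF frac_poly_conv[OF that] laplace_conv_cmult[OF laplace_conv_1[OF that], of c]] by simp
    have "laplace f (s + 1) = (s + 1) * laplace (frac_poly p) (s + 1)"
    proof (rule laplace_derivative[where S = "{t. exp t \<in> \<int>}" and x = "Re s + 1"])
      show "continuous_on {0..} (frac_poly p)"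
        unfolding frac_poly_def
        using isCont_o2[OF _ poly_frac_continuous[of p], of _ exp] p01
        by (intro continuous_at_imp_continuous_on) auto
      show "frac_poly p 0 = 0" by (simp add: frac_poly_def p01)
      show "laplace_conv f (Re s + 1)" unfolding f_def using s by (intro laplace_conv_exp_mult qc) auto
      show "laplace_conv (frac_poly p) (Re s + 1)" using s by (intro frac_poly_conv) auto
      obtain B where B: "\<And>t. \<bar>frac_poly p t\<bar> \<le> B" using frac_poly_bounded by metis
      have "((\<lambda>t. B * exp (- (Re s + 1) * t)) \<longlongrightarrow> B * 0) at_top"
        using s by (intro tendsto_intros exp_minus_tendsto_0) auto
      hence "((\<lambda>t. B * exp (- (Re s + 1) * t)) \<longlongrightarrow> 0) at_top" by simp
      thus "((\<lambda>t. frac_poly p t * exp (- (Re s + 1) * t)) \<longlongrightarrow> 0) at_top"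
        by (rule Lim_null_comparison[rotated]) (simp add: abs_mult B mult_right_mono)
      fix t :: real assume "t > 0" "t \<notin> {t. exp t \<in> \<int>}"
      hence t: "exp t \<notin> \<int>" by simp
      \<comment> \<open>Off the integers the floor is locally constant, so this is differentiated as
        a polynomial in e^t.\<close>
      have "((\<lambda>t. poly p (exp t - of_int \<lfloor>exp t\<rfloor>)) has_real_derivative f t) (at t)"
      proof -
        have "((\<lambda>y. poly p (exp y - of_int \<lfloor>exp t\<rfloor>)) has_real_derivative poly (pderiv p) (exp t - of_int \<lfloor>exp t\<rfloor>) * exp t) (at t)"
          by (rule DERIV_chain'[OF _ poly_DERIV]) (auto intro!: derivative_eq_intros)
        moreover have "poly (pderiv p) (exp t - of_int \<lfloor>exp t\<rfloor>) * exp t = f t"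
          by (simp add: pd f_def frac_poly_def frac_def algebra_simps)
        moreover have "eventually (\<lambda>y. poly p (exp y - of_int \<lfloor>exp t\<rfloor>) = poly p (exp y - of_int \<lfloor>exp y\<rfloor>)) (nhds t)"
        proof -
          have "eventually (\<lambda>y. of_int \<lfloor>exp t\<rfloor> < exp y) (nhds t)" "eventually (\<lambda>y. exp y < of_int \<lfloor>exp t\<rfloor> + 1) (nhds t)"
          proof -
            have "isCont exp t" by simp
            hence lim: "(exp \<longlongrightarrow> exp t) (nhds t)" by (simp add: isCont_def tendsto_at_iff_tendsto_nhds)
            have "of_int \<lfloor>exp t\<rfloor> < exp t" using t by (metis Ints_of_int antisym_conv2 of_int_floor_le)
            thus "eventually (\<lambda>y. of_int \<lfloor>exp t\<rfloor> < exp y) (nhds t)" by (rule order_tendstoD(1)[OF lim])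
            show "eventually (\<lambda>y. exp y < of_int \<lfloor>exp t\<rfloor> + 1) (nhds t)"
              by (rule order_tendstoD(2)[OF lim]) linarith
          qed
          thus ?thesis
          proof eventually_elim
            case (elim y)
            hence "\<lfloor>exp y\<rfloor> = \<lfloor>exp t\<rfloor>" by (intro floor_unique) auto
            thus ?case by simp
          qed
        qed
        ultimately show ?thesis by (subst DERIV_cong_ev[OF refl _ refl, symmetric]) auto
      qed
      thus "(frac_poly p has_real_derivative f t) (at t)"
        by (simp add: frac_poly_def[abs_def] frac_def[abs_def])
    qed (use s finite_exp_Ints in auto)
    also have "laplace f (s + 1) = laplace (\<lambda>t. frac_poly q t - c * 1) s"
      unfolding f_def by (subst laplace_exp_mult) simp
    also have "\<dots> = laplace (frac_poly q) s - of_real c / s"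
      unfolding laplace_diff[OF frac_poly_conv[OF s] laplace_conv_cmult[OF laplace_conv_1[OF s]]]
        laplace_cmult laplace_1[OF s] by simp
    finally show "laplace (frac_poly q) s = of_real c / s + (s + 1) * laplace (frac_poly p) (s + 1)"
      by (simp add: algebra_simps)
  qed
qed

text \<open>Each use of the shift identity gains one unit strip. A pole of the shifted transform at
  -1 is cancelled by the factor s + 1, so the only pole left is at 0. The induction runs over all
  \<open>q\<close>, since the shift changes the polynomial.\<close>

lemma frac_poly_continuation:
  "\<exists>f c. f holomorphic_on {s. Re s > - real m} \<and> (\<forall>s. Re s > 0 \<longrightarrow> laplace (frac_poly q) s = f s + c / s)"
proof (induction m arbitrary: q)
  case 0
  have "laplace (frac_poly q) holomorphic_on {s. Re s > 0}"
    by (intro laplace_holomorphic frac_poly_conv)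
  thus ?case by (intro exI[of _ "laplace (frac_poly q)"] exI[of _ 0]) auto
next
  case (Suc m)
  obtain p c where pc: "\<And>s. Re s > 0 \<Longrightarrow> laplace (frac_poly q) s = of_real c / s + (s + 1) * laplace (frac_poly p) (s + 1)"
    using frac_poly_shift by blast
  obtain f d where hol: "f holomorphic_on {s. Re s > - real m}"
    and f: "\<And>s. Re s > 0 \<Longrightarrow> laplace (frac_poly p) s = f s + d / s" using Suc[of p] by auto
  have "(f \<circ> (\<lambda>s. s + 1)) holomorphic_on {s. Re s > - real (Suc m)}"
    by (rule holomorphic_on_compose_gen[OF _ hol]) (auto intro!: holomorphic_intros)
  hence "(\<lambda>s. (s + 1) * f (s + 1) + d) holomorphic_on {s. Re s > - real (Suc m)}"
    by (auto simp: o_def intro!: holomorphic_intros)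
  moreover have "laplace (frac_poly q) s = ((s + 1) * f (s + 1) + d) + of_real c / s" if "Re s > 0" for s
  proof -
    have "s + 1 \<noteq> 0" using that by (auto simp: complex_eq_iff)
    thus ?thesis using that by (simp add: pc f distrib_left)
  qed
  ultimately show ?case by blast
qed

section \<open>The zeta function and its entire multiple\<close>

lemma card_nat_le_real: "x \<ge> 0 \<Longrightarrow> card {n. 1 \<le> n \<and> real n \<le> x} = nat \<lfloor>x\<rfloor>"
proof -
  assume "x \<ge> 0"
  hence "{n. 1 \<le> n \<and> real n \<le> x} = {1..nat \<lfloor>x\<rfloor>}" by (auto simp: le_nat_floor) linarith
  thus ?thesis by simp
qed

abbreviation frac_exp :: "real \<Rightarrow> real" where "frac_exp \<equiv> frac_poly [:0, 1:]"

text \<open>The counting function of the integers is e^t minus the fractional part of e^t; the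
  exponential gives the pole at 1, the fractional part the rest.\<close>

lemma zeta_series:
  assumes "Re s > 1"
  shows "(\<lambda>n. 1 / of_nat (Suc n) powr s) sums (s / (s - 1) - s * laplace frac_exp s)"
proof -
  define S where "S = (\<lambda>t. \<Sum>n | 1 \<le> n \<and> real n \<le> exp t. 1 :: real)"
  have "S = (\<lambda>t. exp (1 * t) * 1 - frac_exp t)"
    by (auto simp: S_def card_nat_le_real[simplified] frac_poly_def frac_def fun_eq_iff)
  hence "laplace S s = laplace (\<lambda>t. exp (1 * t) * 1 - frac_exp t) s" by simp
  also have "\<dots> = laplace (\<lambda>_. 1) (s - of_real 1) - laplace frac_exp s"
    by (subst laplace_diff) (use assms in \<open>auto intro!: laplace_conv_exp_mult[of "\<lambda>_. 1" _ 1, simplified] laplace_conv_1 frac_poly_conv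
       simp: laplace_exp_mult[of 1 "\<lambda>_. 1", simplified]\<close>)
  also have "laplace (\<lambda>_. 1) (s - of_real 1) = 1 / (s - 1)" using assms by (subst laplace_1) auto
  finally have "laplace S s = 1 / (s - 1) - laplace frac_exp s" .
  moreover have "(\<lambda>n. of_real 1 / of_nat (Suc n) powr s) sums (s * laplace S s)"
    unfolding S_def by (rule laplace_partial_sums) (use assms in auto)
  ultimately show ?thesis by (simp add: right_diff_distrib)
qed

text \<open>The factor s - 1 removes the pole at 1, and s removes the pole c/s of the continued
  transform, so the functions on the half-planes are holomorphic throughout and glue to an entire
  one.\<close>

lemma zeta_continuation:
  "\<exists>Z. Z holomorphic_on UNIV \<and> (\<forall>s. Re s > 0 \<longrightarrow> Z s = s - s * (s - 1) * laplace frac_exp s)"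
proof -
  have "\<exists>g. g holomorphic_on {s. Re s > - real m} \<and> (\<forall>s. Re s > 0 \<longrightarrow> g s = s - s * (s - 1) * laplace frac_exp s)" for m
  proof -
    obtain f c where f: "f holomorphic_on {s. Re s > - real m}" "\<And>s. Re s > 0 \<Longrightarrow> laplace frac_exp s = f s + c / s"
      using frac_poly_continuation by blast
    have "(\<lambda>s. s - s * (s - 1) * f s - c * (s - 1)) holomorphic_on {s. Re s > - real m}"
      by (intro holomorphic_intros f)
    moreover have "s - s * (s - 1) * f s - c * (s - 1) = s - s * (s - 1) * laplace frac_exp s" if "Re s > 0" for s
    proof -
      have "s \<noteq> 0" using that by auto
      thus ?thesis using that by (simp add: f field_simps)
    qed
    ultimately show ?thesis by blast
  qed
  then obtain g where g: "\<And>m. g m holomorphic_on {s. Re s > - real m}"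
      "\<And>m s. Re s > 0 \<Longrightarrow> g m s = s - s * (s - 1) * laplace frac_exp s" by metis
  have eq: "g m s = g k s" if "Re s > - real m" "Re s > - real k" for m k s
    by (rule holomorphic_eq_on_halfplane_real[where c = "max (- real m) (- real k)" and d = 0])
       (use that in \<open>auto intro: holomorphic_on_subset[OF g(1)] simp: g(2)\<close>)
  \<comment> \<open>Any index m with -m < Re s gives the same value; this one is large
    enough.\<close>
  define Z where "Z = (\<lambda>s. g (nat \<lceil>1 - Re s\<rceil>) s)"
  have Z: "Z s = g m s" if "Re s > - real m" for m s
  proof -
    have "Re s > - real (nat \<lceil>1 - Re s\<rceil>)" by linarith
    thus ?thesis unfolding Z_def using that by (intro eq)
  qed
  have "Z holomorphic_on (\<Union>m. {s. Re s > - real m})"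
  proof (rule holomorphic_on_UN_open)
    fix m show "Z holomorphic_on {s. Re s > - real m}"
      by (rule holomorphic_transform[OF g(1)]) (auto simp: Z)
  qed (auto simp: open_halfspace_Re_gt)
  also have "(\<Union>m. {s. Re s > - real m}) = UNIV"
  proof -
    have "\<exists>m. - real m < Re s" for s by (metis minus_less_iff reals_Archimedean2)
    thus ?thesis by blast
  qed
  finally show ?thesis using Z[of 0] g(2) by auto
qed

text \<open>\<open>zeta\<close> is a choice, so its defining properties become available once some
  function is known to have them; Z(s) / (s - 1) is such a function.\<close>

lemma zeta_properties:
  shows zeta_holomorphic: "zeta holomorphic_on - {1}"
    and zeta_sums: "Re s > 1 \<Longrightarrow> (\<lambda>n. 1 / of_nat (Suc n) powr s) sums zeta s"
proof -
  obtain Z where Z: "Z holomorphic_on UNIV" "\<And>s. Re s > 0 \<Longrightarrow> Z s = s - s * (s - 1) * laplace frac_exp s"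
    using zeta_continuation by blast
  have "\<exists>f. f holomorphic_on (- {1}) \<and> (\<forall>s. Re s > 1 \<longrightarrow> (\<lambda>n. 1 / of_nat (Suc n) powr s) sums f s)"
  proof (intro exI[of _ "\<lambda>s. Z s / (s - 1)"] conjI allI impI)
    show "(\<lambda>s. Z s / (s - 1)) holomorphic_on - {1}"
      by (intro holomorphic_intros holomorphic_on_subset[OF Z(1)]) auto
    fix s :: complex assume s: "Re s > 1"
    hence "s - 1 \<noteq> 0" by (auto simp: complex_eq_iff)
    hence "Z s / (s - 1) = s / (s - 1) - s * laplace frac_exp s"
      using s by (simp add: Z field_simps)
    thus "(\<lambda>n. 1 / of_nat (Suc n) powr s) sums (Z s / (s - 1))" using zeta_series[OF s] by simp
  qed
  from someI_ex[OF this] show "zeta holomorphic_on - {1}"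
    "Re s > 1 \<Longrightarrow> (\<lambda>n. 1 / of_nat (Suc n) powr s) sums zeta s" unfolding zeta_def by auto
qed

text \<open>The value at 1 is the residue of zeta, which makes this function entire. Away from 1 it
  has the same zeros as zeta.\<close>

definition zeta_reg :: "complex \<Rightarrow> complex" where
  "zeta_reg s = (if s = 1 then 1 else (s - 1) * zeta s)"

text \<open>The plane without 1 is connected, so agreement through the series on Re s > 1 extends
  everywhere; this identifies the chosen \<open>zeta\<close> with the constructed
  continuation.\<close>

lemma zeta_reg_eq_aux:
  assumes "Z holomorphic_on UNIV" "\<And>s. Re s > 0 \<Longrightarrow> Z s = s - s * (s - 1) * laplace frac_exp s"
  shows "zeta_reg s = Z s"
proof (cases "s = 1")
  case True
  thus ?thesis using assms(2)[of 1] by (simp add: zeta_reg_def)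
next
  case False
  have "(s - 1) * zeta s = Z s"
  proof (rule analytic_continuation_open[where s = "{s. Re s > 1}" and s' = "- {1}" and f = "\<lambda>s. (s - 1) * zeta s" and g = Z])
    show "open {s. Re s > 1}" by (rule open_halfspace_Re_gt)
    have "2 \<in> {s. Re s > 1}" by simp
    thus "{s. Re s > 1} \<noteq> {}" by blast
    show "connected (- {1 :: complex})" by (simp add: connected_punctured_universe)
    show "(\<lambda>s. (s - 1) * zeta s) holomorphic_on - {1}" by (intro holomorphic_intros zeta_holomorphic)
    fix z assume "z \<in> {s. Re s > 1}"
    hence z: "Re z > 1" by simp
    hence "z - 1 \<noteq> 0" by (auto simp: complex_eq_iff)
    moreover have "zeta z = z / (z - 1) - z * laplace frac_exp z"
      using zeta_sums[OF z] zeta_series[OF z] by (rule sums_unique2)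
    ultimately show "(z - 1) * zeta z = Z z" using z by (simp add: assms(2) field_simps)
  qed (use False in \<open>auto intro: holomorphic_on_subset[OF assms(1)]\<close>)
  thus ?thesis using False by (simp add: zeta_reg_def)
qed

lemma zeta_reg_holomorphic: "zeta_reg holomorphic_on UNIV"
  using zeta_continuation zeta_reg_eq_aux by (metis ext)

lemma zeta_reg_laplace: "Re s > 0 \<Longrightarrow> zeta_reg s = s - s * (s - 1) * laplace frac_exp s"
  using zeta_continuation zeta_reg_eq_aux by metis

text \<open>The fractional part lies in [0,1], so its transform L at x satisfies 0 \<le> L \<le>
  1/x. Then x - x(x - 1)L is at least 1 for x \<ge> 1 and at least x for x < 1. Nonvanishing here is
  the input of Landau's theorem, and it excludes a zero at 1/2.\<close>

lemma zeta_reg_real_pos: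
  assumes "x > 0"
  shows "zeta_reg (of_real x) \<in> \<real>" "Re (zeta_reg (of_real x)) > 0"
proof -
  define L where "L = (LINT t:{0..}|lborel. frac_exp t * exp (- x * t))"
  have eq: "zeta_reg (of_real x) = of_real (x - x * (x - 1) * L)"
    using assms by (subst zeta_reg_laplace) (auto simp: laplace_of_real L_def)
  show "zeta_reg (of_real x) \<in> \<real>" unfolding eq by simp
  have "L \<ge> 0" unfolding L_def set_lebesgue_integral_def
    by (intro Bochner_Integration.integral_nonneg) (auto simp: frac_poly_def indicator_def)
  moreover have "L \<le> 1 / x"
  proof -
    have "L \<le> (LINT t:{0..}|lborel. 1 * exp (- x * t))" unfolding L_def
    proof (rule set_integral_mono)
      show "set_integrable lborel {0..} (\<lambda>t. frac_exp t * exp (- x * t))"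
        "set_integrable lborel {0..} (\<lambda>t. 1 * exp (- x * t))"
        using frac_poly_conv[OF assms] laplace_conv_1[OF assms] unfolding laplace_conv_def by auto
    qed (auto simp: frac_poly_def less_imp_le[OF frac_lt_1])
    also have "complex_of_real (LINT t:{0..}|lborel. 1 * exp (- x * t)) = of_real (1 / x)"
      unfolding laplace_of_real[of "\<lambda>_. 1", symmetric] using assms by (subst laplace_1) auto
    hence "(LINT t:{0..}|lborel. 1 * exp (- x * t)) = 1 / x" by (simp only: of_real_eq_iff)
    finally show ?thesis .
  qed
  ultimately have "x - x * (x - 1) * L > 0"
  proof (cases "x \<ge> 1")
    case True
    have "x * (x - 1) * L \<le> x * (x - 1) * (1 / x)" using True \<open>L \<le> 1 / x\<close> by (intro mult_left_mono) auto
    also have "x * (x - 1) * (1 / x) = x - 1" using assms by simp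
    finally show ?thesis by linarith
  next
    case False
    have "x * (x - 1) * L \<le> 0" using False assms \<open>L \<ge> 0\<close> by (intro mult_nonpos_nonneg mult_nonneg_nonpos) auto
    thus ?thesis using assms by linarith
  qed
  thus "Re (zeta_reg (of_real x)) > 0" unfolding eq by simp
qed

text \<open>Reflection principle: \<open>zeta_reg\<close> is real on the positive axis. The abscissa
  \<open>Re s - 1\<close> merely supplies a half-plane containing s.\<close>

lemma zeta_reg_cnj: "zeta_reg (cnj s) = cnj (zeta_reg s)"
proof -
  have "(cnj \<circ> zeta_reg \<circ> cnj) s = zeta_reg s"
  proof (rule holomorphic_eq_on_halfplane_real[where c = "Re s - 1" and d = 0 and f = "cnj \<circ> zeta_reg \<circ> cnj"])
    show "(cnj \<circ> zeta_reg \<circ> cnj) holomorphic_on {z. Re z > Re s - 1}"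
      by (intro holomorphic_on_compose_cnj_cnj holomorphic_on_subset[OF zeta_reg_holomorphic] open_halfspace_Re_gt) auto
    show "zeta_reg holomorphic_on {z. Re z > Re s - 1}" by (rule holomorphic_on_subset[OF zeta_reg_holomorphic]) auto
    show "(cnj \<circ> zeta_reg \<circ> cnj) (of_real x) = zeta_reg (of_real x)" if "x > 0" for x
      using zeta_reg_real_pos(1)[OF that] by (simp add: Reals_cnj_iff)
  qed auto
  thus ?thesis by (metis comp_apply complex_cnj_cnj)
qed

section \<open>The Moebius function and its summatory function\<close>

lemma moebius_mu_prime_mult:
  assumes "prime p" "\<not> p dvd d"
  shows "moebius_mu (p * d) = - moebius_mu d"
proof (cases "squarefree d")
  case True
  hence d: "d \<noteq> 0" by (auto intro!: Nat.gr0I)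
  have "coprime p d" using assms by (simp add: prime_imp_coprime)
  hence "squarefree (p * d)" using True assms by (intro squarefree_mult_coprime) (auto intro: squarefree_prime)
  moreover have "prime_factors (p * d) = insert p (prime_factors d)"
    using assms d by (subst prime_factorization_mult) (auto simp: prime_factorization_prime)
  moreover have "p \<notin> prime_factors d" using assms by auto
  ultimately show ?thesis using True by (simp add: moebius_mu_def)
next
  case False
  hence "\<not> squarefree (p * d)" by (metis squarefree_multD(2))
  thus ?thesis using False by (simp add: moebius_mu_def)
qed

text \<open>A prime \<open>p\<close> dividing \<open>n\<close> pairs the squarefree divisors \<open>d\<close> prime to \<open>p\<close> with \<open>p d\<close>.\<close>

lemma sum_moebius_mu_divisors:
  assumes "n \<ge> 1"
  shows "(\<Sum>d | d dvd n. moebius_mu d) = (if n = 1 then 1 else 0)"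
proof (cases "n = 1")
  case True
  thus ?thesis by (simp add: moebius_mu_def)
next
  case False
  then obtain p where p: "prime p" "p dvd n" using prime_factor_nat by blast
  define A where "A = {d. d dvd n \<and> squarefree d \<and> \<not> p dvd d}"
  define B where "B = {d. d dvd n \<and> squarefree d \<and> p dvd d}"
  have fin: "finite {d. d dvd n}" using assms by (intro finite_divisors_nat) auto
  have finAB: "finite A" "finite B" using finite_subset[OF _ fin] by (auto simp: A_def B_def)
  have "(\<Sum>d | d dvd n. moebius_mu d) = (\<Sum>d\<in>A \<union> B. moebius_mu d)"
    using fin by (intro sum.mono_neutral_right) (auto simp: A_def B_def moebius_mu_def)
  also have "\<dots> = (\<Sum>d\<in>A. moebius_mu d) + (\<Sum>d\<in>B. moebius_mu d)"
    using finAB by (intro sum.union_disjoint) (auto simp: A_def B_def)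
  also have "(\<Sum>d\<in>B. moebius_mu d) = (\<Sum>d\<in>A. moebius_mu (p * d))"
  proof (rule sum.reindex_bij_witness[of _ "\<lambda>d. p * d" "\<lambda>d. d div p"])
    fix d assume d: "d \<in> A"
    have "coprime p d" using p d by (auto simp: A_def intro: prime_imp_coprime)
    thus "p * d \<in> B" using d p by (auto simp: A_def B_def divides_mult squarefree_mult_coprime squarefree_prime)
    show "p * d div p = d" using p by (simp add: prime_gt_0_nat)
  next
    fix d assume d: "d \<in> B"
    then obtain e where e: "d = p * e" by (auto simp: B_def)
    have p0: "p > 0" using p by (simp add: prime_gt_0_nat)
    have "\<not> p dvd e"
    proof
      assume "p dvd e"
      hence "p ^ 2 dvd d" by (auto simp: e power2_eq_square)
      hence "p dvd 1" using d unfolding B_def squarefree_def by blast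
      thus False using p by simp
    qed
    thus "d div p \<in> A" using d p0 by (auto simp: e A_def B_def dest: squarefree_multD dvd_mult_right)
  qed (auto simp: B_def)
  also have "\<dots> = - (\<Sum>d\<in>A. moebius_mu d)"
    using p by (simp add: moebius_mu_prime_mult A_def sum_negf[symmetric])
  finally show ?thesis using False by simp
qed

lemma abs_moebius_mu_le: "\<bar>moebius_mu n\<bar> \<le> 1"
  by (simp add: moebius_mu_def power_abs)

lemma of_nat_powr_of_real: "of_nat n powr complex_of_real x = of_real (real n powr x)"
  using powr_of_real[of "real n" x] by simp

lemma has_sum_powr_minus:
  assumes "x > 1"
  shows "((\<lambda>n. real n powr - x) has_sum Re (zeta (of_real x))) {1..}"
    and "zeta (of_real x) = of_real (Re (zeta (of_real x)))"
proof -
  have eq: "1 / of_nat (Suc n) powr complex_of_real x = of_real (real (Suc n) powr - x)" for n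
    by (simp add: of_nat_powr_of_real powr_minus divide_inverse del: of_nat_Suc)
  have "(\<lambda>n. complex_of_real (real (Suc n) powr - x)) sums zeta (of_real x)"
    using zeta_sums[of "of_real x"] assms by (simp only: eq) simp
  hence *: "(\<lambda>n. real (Suc n) powr - x) sums Re (zeta (of_real x))"
    and **: "(\<lambda>n. Im (complex_of_real (real (Suc n) powr - x))) sums Im (zeta (of_real x))"
    by (auto simp only: sums_complex_iff Re_complex_of_real)
  show "zeta (of_real x) = of_real (Re (zeta (of_real x)))"
    using ** sums_unique2[OF _ sums_zero] by (auto simp: complex_eq_iff)
  have "((\<lambda>n. real (Suc n) powr - x) has_sum Re (zeta (of_real x))) UNIV"
    using * by (intro norm_summable_imp_has_sum) (auto simp: sums_iff simp del: of_nat_Suc)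
  also have "?this \<longleftrightarrow> ((\<lambda>n. real n powr - x) has_sum Re (zeta (of_real x))) {1..}"
    by (rule has_sum_reindex_bij_witness[of _ "\<lambda>n. n - 1" Suc]) auto
  finally show "((\<lambda>n. real n powr - x) has_sum Re (zeta (of_real x))) {1..}" .
qed

text \<open>Dirichlet convolution: both series converge absolutely, so their product may be
  regrouped by n = d m, and the divisor sum of the Moebius function leaves only n = 1.\<close>

lemma moebius_series_inverse:
  assumes x: "x > 1" and S: "(\<lambda>n. of_int (moebius_mu (Suc n)) * real (Suc n) powr - x) sums S"
  shows "S * Re (zeta (of_real x)) = 1"
proof -
  define Z where "Z = Re (zeta (of_real x))"
  define a where "a = (\<lambda>n. real_of_int (moebius_mu n) * real n powr - x)"
  define b where "b = (\<lambda>n. real n powr - x)"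
  have b: "(b has_sum Z) {1..}" using has_sum_powr_minus[OF x] by (simp add: b_def Z_def)
  have ab: "\<bar>a n\<bar> \<le> b n" for n
    using abs_moebius_mu_le[of n] by (simp add: a_def b_def abs_mult mult_left_le_one_le flip: of_int_abs)
  have "((\<lambda>n. a (Suc n)) has_sum S) UNIV"
  proof (intro norm_summable_imp_has_sum)
    have "summable (\<lambda>n. b (Suc n))"
      using x summable_Suc_iff[of b] by (simp add: b_def summable_real_powr_iff)
    thus "summable (\<lambda>n. norm (a (Suc n)))"
      by (rule summable_comparison_test'[of _ 0]) (use ab in auto)
  qed (use S in \<open>simp add: a_def\<close>)
  also have "?this \<longleftrightarrow> (a has_sum S) {1..}"
    by (rule has_sum_reindex_bij_witness[of _ "\<lambda>n. n - 1" Suc]) auto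
  finally have a: "(a has_sum S) {1..}" .
  have bb: "(\<lambda>(d, m). b d * b m) summable_on {1..} \<times> {1..}"
  proof (rule summable_on_SigmaI[where g = "\<lambda>d. b d * Z"])
    show "((\<lambda>m. case (d, m) of (d, m) \<Rightarrow> b d * b m) has_sum b d * Z) {1..}" for d
      using has_sum_cmult_right[OF b] by simp
    show "(\<lambda>d. b d * Z) summable_on {1..}"
      by (rule summable_on_cmult_left[OF has_sum_imp_summable[OF b]])
  qed (auto simp: b_def)
  have "(\<lambda>p. norm (a (fst p) * b (snd p))) summable_on {1..} \<times> {1..}"
  proof (rule summable_on_comparison_test[OF bb])
    fix p :: "nat \<times> nat"
    have "b (snd p) \<ge> 0" by (simp add: b_def)
    thus "norm (a (fst p) * b (snd p)) \<le> (case p of (d, m) \<Rightarrow> b d * b m)"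
      using ab by (simp add: abs_mult case_prod_unfold mult_right_mono)
  qed auto
  hence "(\<lambda>p. a (fst p) * b (snd p)) summable_on {1..} \<times> {1..}" by (rule abs_summable_summable)
  hence ab_sum: "((\<lambda>p. a (fst p) * b (snd p)) has_sum (S * Z)) ({1..} \<times> {1..})"
  proof (intro has_sum_SigmaI[where g = "\<lambda>d. a d * Z"])
    show "((\<lambda>m. a (fst (d, m)) * b (snd (d, m))) has_sum a d * Z) {1..}" for d
      using has_sum_cmult_right[OF b] by simp
    show "((\<lambda>d. a d * Z) has_sum S * Z) {1..}" by (rule has_sum_cmult_left[OF a])
  qed
  \<comment> \<open>The pair (d, m) becomes (n, d) with n = d m. Since d^(-x) m^(-x) = n^(-x), the
    weight depends on n only and leaves the divisor sum.\<close>
  also have "?this \<longleftrightarrow> ((\<lambda>p. of_int (moebius_mu (snd p)) * b (fst p)) has_sum (S * Z)) (SIGMA n:{1..}. {d. d dvd n})"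
  proof (rule has_sum_reindex_bij_witness[of _ "\<lambda>p. (snd p, fst p div snd p)" "\<lambda>p. (fst p * snd p, fst p)"], goal_cases)
    case (1 p) thus ?case by auto
  next
    case (2 p) thus ?case by (cases p) (simp add: one_le_mult_iff)
  next
    case (3 p) thus ?case by auto
  next
    case (4 p)
    hence "snd p dvd fst p" "fst p \<ge> 1" by auto
    thus ?case by (cases p) (auto simp: Suc_le_eq dvd_pos_nat div_greater_zero_iff dvd_imp_le intro!: Nat.gr0I)
  next
    case (5 p) thus ?case by (simp add: a_def b_def powr_mult)
  qed auto
  finally have "((\<lambda>n. \<Sum>d | d dvd n. of_int (moebius_mu d) * b n) has_sum (S * Z)) {1..}"
    by (rule has_sum_SigmaD) (auto intro!: has_sum_finite finite_divisors_nat)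
  also have "?this \<longleftrightarrow> ((\<lambda>n::nat. if n = 1 then 1 else 0) has_sum (S * Z)) {1..}"
  proof (rule has_sum_cong)
    fix n :: nat assume "n \<in> {1..}"
    hence "(\<Sum>d | d dvd n. moebius_mu d) = (if n = 1 then 1 else 0)"
      by (intro sum_moebius_mu_divisors) simp
    hence "real_of_int (\<Sum>d | d dvd n. moebius_mu d) * b n = (if n = 1 then 1 else 0)"
      by (simp add: b_def)
    thus "(\<Sum>d | d dvd n. of_int (moebius_mu d) * b n) = (if n = 1 then 1 else 0)"
      by (simp add: sum_distrib_right)
  qed
  finally have "((\<lambda>n. if n = (1::nat) then 1 else 0) has_sum (S * Z)) {1..}" .
  moreover have "((\<lambda>n. if n = (1::nat) then 1 else 0) has_sum (1 :: real)) {1..}"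
    by (rule has_sum_finite_neutralI[of "{1}"]) auto
  ultimately show ?thesis unfolding Z_def using has_sum_unique by blast
qed

text \<open>The real identity is the starting point; it is extended to a half-plane only after it
  has been rewritten for the normalized integral.\<close>

lemma laplace_mertens:
  assumes "x > 1"
  shows "laplace_conv (\<lambda>t. mertens (exp t)) x"
    and "of_real x * laplace (\<lambda>t. mertens (exp t)) (of_real x) * zeta (of_real x) = 1"
proof -
  define c where "c = (\<lambda>n. real_of_int (moebius_mu n))"
  have c: "\<bar>c n\<bar> \<le> 1" for n using abs_moebius_mu_le[of n] by (simp add: c_def flip: of_int_abs)
  have eq: "mertens (exp t) = (\<Sum>n | 1 \<le> n \<and> real n \<le> exp t. c n)" for t by (simp add: mertens_def c_def)
  show "laplace_conv (\<lambda>t. mertens (exp t)) x"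
    unfolding eq using laplace_partial_sums(1)[OF c, of "of_real x"] assms by simp
  have 1: "(\<lambda>n. of_real (c (Suc n)) / of_nat (Suc n) powr of_real x) sums
      (of_real x * laplace (\<lambda>t. mertens (exp t)) (of_real x))"
    unfolding eq using assms by (intro laplace_partial_sums(2) c) auto
  define S where "S = x * (LINT t:{0..}|lborel. mertens (exp t) * exp (- x * t))"
  have "complex_of_real (c (Suc n)) / of_nat (Suc n) powr of_real x = of_real (c (Suc n) * real (Suc n) powr - x)" for n
    by (simp add: of_nat_powr_of_real powr_minus divide_inverse del: of_nat_Suc)
  hence "(\<lambda>n. complex_of_real (c (Suc n) * real (Suc n) powr - x)) sums of_real S"
    using 1 by (simp add: S_def laplace_of_real)
  hence "(\<lambda>n. c (Suc n) * real (Suc n) powr - x) sums S" by (simp only: sums_of_real_iff)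
  hence "S * Re (zeta (of_real x)) = 1" unfolding c_def by (intro moebius_series_inverse assms)
  hence "complex_of_real S * of_real (Re (zeta (of_real x))) = 1" by (metis of_real_1 of_real_mult)
  thus "of_real x * laplace (\<lambda>t. mertens (exp t)) (of_real x) * zeta (of_real x) = 1"
    using has_sum_powr_minus(2)[OF assms] by (simp add: S_def laplace_of_real)
qed

section \<open>Regularity and trivial bounds for the Mertens function\<close>

lemma mertens_floor: "mertens x = mertens (of_int \<lfloor>x\<rfloor>)"
proof -
  have "real n \<le> x \<longleftrightarrow> real n \<le> of_int \<lfloor>x\<rfloor>" for n
    by (metis le_floor_iff of_int_le_iff of_int_of_nat_eq)
  thus ?thesis unfolding mertens_def by simp
qed

lemma mertens_measurable [measurable]: "mertens \<in> borel_measurable borel"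
proof -
  have "(\<lambda>k::int. mertens (of_int k)) \<in> borel_measurable (count_space UNIV)" by simp
  from measurable_compose[OF measurable_real_floor this] show ?thesis
    by (simp flip: mertens_floor)
qed

text \<open>The trivial bound provides convergence in some right half-plane; the half-plane Re s > 0
  comes later from Landau's theorem.\<close>

lemma abs_mertens_le:
  assumes "x \<ge> 0" shows "\<bar>mertens x\<bar> \<le> x"
proof -
  have "\<bar>mertens x\<bar> \<le> (\<Sum>n | n \<ge> 1 \<and> real n \<le> x. \<bar>of_int (moebius_mu n)\<bar>)"
    unfolding mertens_def by (rule sum_abs)
  also have "\<dots> \<le> (\<Sum>n | n \<ge> 1 \<and> real n \<le> x. 1)"
    using abs_moebius_mu_le by (intro sum_mono) (simp flip: of_int_abs)
  also have "\<dots> = real (nat \<lfloor>x\<rfloor>)" using card_nat_le_real[OF assms] by simp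
  also have "\<dots> \<le> x" using assms by linarith
  finally show ?thesis .
qed

lemma isCont_mertens:
  assumes "x \<notin> \<int>" shows "isCont mertens x"
proof -
  have "eventually (\<lambda>y. y \<in> {of_int \<lfloor>x\<rfloor><..<of_int \<lfloor>x\<rfloor> + 1}) (at x)"
  proof (rule eventually_at_in_open')
    have "of_int \<lfloor>x\<rfloor> \<noteq> x" using assms by (metis Ints_of_int)
    thus "x \<in> {of_int \<lfloor>x\<rfloor><..<of_int \<lfloor>x\<rfloor> + 1}" using of_int_floor_le[of x] real_of_int_floor_add_one_gt[of x] by (auto simp: less_le)
  qed auto
  hence "eventually (\<lambda>y. mertens y = mertens x) (at x)"
  proof eventually_elim
    case (elim y)
    hence "\<lfloor>y\<rfloor> = \<lfloor>x\<rfloor>" by (intro floor_unique) auto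
    thus ?case by (metis mertens_floor)
  qed
  thus ?thesis unfolding isCont_def by (rule tendsto_eventually)
qed

section \<open>The transform of the normalized integral\<close>

context
  fixes \<kappa> :: real
begin

private definition g :: "real \<Rightarrow> real" where "g u = mertens u / u powr \<kappa>"

private definition I :: "real \<Rightarrow> real" where "I t = integral {1..exp t} g"

private lemma g_le:
  assumes "1 \<le> u" "u \<le> b"
  shows "\<bar>g u\<bar> \<le> b * b powr \<bar>\<kappa>\<bar>"
proof -
  have "\<bar>g u\<bar> = \<bar>mertens u\<bar> * u powr - \<kappa>" by (simp add: g_def powr_minus divide_inverse abs_mult)
  also have "\<dots> \<le> b * b powr \<bar>\<kappa>\<bar>"
  proof (intro mult_mono)
    show "\<bar>mertens u\<bar> \<le> b" using abs_mertens_le[of u] assms by simp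
    have "u powr - \<kappa> \<le> u powr \<bar>\<kappa>\<bar>" using assms by (intro powr_mono) auto
    also have "\<dots> \<le> b powr \<bar>\<kappa>\<bar>" using assms by (intro powr_mono2) auto
    finally show "u powr - \<kappa> \<le> b powr \<bar>\<kappa>\<bar>" .
  qed (use assms in auto)
  finally show ?thesis .
qed

private lemma g_integrable: "g integrable_on {1..b}"
proof -
  have "g \<in> borel_measurable borel" unfolding g_def[abs_def] by measurable
  hence "set_integrable lborel {1..b} g"
    unfolding set_integrable_def using g_le[of _ b]
    by (intro integrableI_bounded_set_indicator[where B = "b * b powr \<bar>\<kappa>\<bar>"]) (auto simp: emeasure_lborel_Icc_eq)
  thus ?thesis by (rule set_borel_integral_eq_integral)
qed

text \<open>One factor e^t bounds the length of the interval, one bounds M(u), and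
  \<open>\<bar>\<kappa>\<bar>\<close> covers the weight for either sign of \<kappa>.\<close>

private lemma I_bound:
  assumes "t \<ge> 0" shows "\<bar>I t\<bar> \<le> 1 * exp ((2 + \<bar>\<kappa>\<bar>) * t)"
proof -
  have "norm (integral {1..exp t} g) \<le> integral {1..exp t} (\<lambda>_. exp t * exp t powr \<bar>\<kappa>\<bar>)"
    using g_le by (intro integral_norm_bound_integral g_integrable) auto
  also have "\<dots> = (exp t - 1) * (exp t * exp t powr \<bar>\<kappa>\<bar>)" using assms by simp
  also have "\<dots> \<le> exp t * (exp t * exp t powr \<bar>\<kappa>\<bar>)" by (intro mult_right_mono) auto
  also have "\<dots> = 1 * exp ((2 + \<bar>\<kappa>\<bar>) * t)" by (simp add: powr_def exp_add[symmetric] algebra_simps)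
  finally show ?thesis by (simp add: I_def)
qed

text \<open>For negative t the interval of integration is empty and the integral is 0, hence I(t) =
  I(max 0 t). Continuity on the whole line also yields measurability.\<close>

private lemma I_continuous: "continuous_on UNIV I"
proof -
  have "continuous_on {0..b} I" for b
    unfolding I_def
    by (rule continuous_on_compose2[OF indefinite_integral_continuous_1[OF g_integrable[of "exp b"]]])
       (auto intro!: continuous_intros)
  hence 1: "continuous_on {0..<b} I" for b by (rule continuous_on_subset[of "{0..b}"]) auto
  have "continuous_on UNIV (\<lambda>t. I (max 0 t))"
  proof -
    have "isCont (\<lambda>t. I (max 0 t)) t" for t
    proof -
      have "continuous_on {..<\<bar>t\<bar> + 1} (\<lambda>t. I (max 0 t))"
        by (rule continuous_on_compose2[OF 1[of "\<bar>t\<bar> + 1"]]) (auto intro!: continuous_intros)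
      thus ?thesis by (rule continuous_on_interior) (auto simp: interior_open)
    qed
    thus ?thesis by (simp add: continuous_on_eq_continuous_at)
  qed
  moreover have "I (max 0 t) = I t" for t
    by (cases "t \<ge> 0") (auto simp: I_def max_def)
  ultimately show ?thesis by simp
qed

private lemma I_deriv:
  assumes "t > 0" "exp t \<notin> \<int>"
  shows "(I has_real_derivative exp ((1 - \<kappa>) * t) * mertens (exp t)) (at t)"
proof -
  have u: "1 < exp t" using assms by simp
  have "isCont g (exp t)" unfolding g_def using assms(2)
    by (intro continuous_intros isCont_mertens) auto
  hence "((\<lambda>u. integral {1..u} g) has_vector_derivative g (exp t)) (at (exp t) within ({1..exp t + 1} - {}))"
    using u by (intro integral_has_vector_derivative_continuous_at[OF g_integrable]) (auto intro: continuous_at_imp_continuous_at_within)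
  moreover have "at (exp t) within ({1..exp t + 1} - {}) = at (exp t)"
    using u by (simp add: at_within_Icc_at)
  ultimately have "((\<lambda>u. integral {1..u} g) has_real_derivative g (exp t)) (at (exp t))"
    by (simp add: has_real_derivative_iff_has_vector_derivative)
  from DERIV_chain2[OF this DERIV_exp] have "(I has_real_derivative g (exp t) * exp t) (at t)"
    by (simp add: I_def[abs_def])
  moreover have "g (exp t) * exp t = exp ((1 - \<kappa>) * t) * mertens (exp t)"
    by (simp add: g_def powr_def left_diff_distrib exp_diff)
  ultimately show ?thesis by simp
qed

private lemma normalized_integral_exp: "normalized_integral \<kappa> (exp t) = exp ((\<kappa> - 3 / 2) * t) * I t"
proof -
  have "1 / exp t powr (3 / 2 - \<kappa>) = exp ((\<kappa> - 3 / 2) * t)"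
  proof -
    have "1 / exp t powr (3 / 2 - \<kappa>) = exp (- ((3 / 2 - \<kappa>) * t))"
      by (simp only: powr_def exp_minus inverse_eq_divide) simp
    also have "- ((3 / 2 - \<kappa>) * t) = (\<kappa> - 3 / 2) * t" by (simp add: algebra_simps)
    finally show ?thesis .
  qed
  thus ?thesis by (simp add: normalized_integral_def I_def g_def[abs_def])
qed

lemma normalized_integral_exp_continuous: "continuous_on UNIV (\<lambda>t. normalized_integral \<kappa> (exp t))"
  unfolding normalized_integral_exp by (intro continuous_intros I_continuous)

text \<open>Two shifts combine: e^((\<kappa> - 3/2)t) I(t) moves the argument from x to y = x + 3/2
  - \<kappa>, and I'(t) = e^((1 - \<kappa>)t) M(e^t) moves it from y to x + 1/2. The threshold on x
  is a convenient one ensuring y > 2 + \<open>\<bar>\<kappa>\<bar>\<close> and x + 1/2 > 1.\<close>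

lemma laplace_normalized_integral:
  assumes x: "x > 3 + 3 * \<bar>\<kappa>\<bar>"
  shows "laplace_conv (\<lambda>t. normalized_integral \<kappa> (exp t)) x"
    and "laplace (\<lambda>t. normalized_integral \<kappa> (exp t)) (of_real x) *
       ((of_real x + 1 / 2) * (of_real x + 3 / 2 - of_real \<kappa>) * zeta_reg (of_real x + 1 / 2)) = of_real x - 1 / 2"
proof -
  define y where "y = x + 3 / 2 - \<kappa>"
  have y: "y > 2 + \<bar>\<kappa>\<bar>" using x by (auto simp: y_def)
  have I_conv: "laplace_conv I y"
    using borel_measurable_continuous_onI[OF I_continuous] I_bound y by (rule laplace_conv_bounded)
  show "laplace_conv (\<lambda>t. normalized_integral \<kappa> (exp t)) x"
    unfolding normalized_integral_exp
    by (rule laplace_conv_exp_mult) (use I_conv in \<open>simp add: y_def algebra_simps\<close>)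
  define f where "f = (\<lambda>t. exp ((1 - \<kappa>) * t) * mertens (exp t))"
  have f_conv: "laplace_conv f y"
    unfolding f_def using x by (intro laplace_conv_exp_mult laplace_mertens) (auto simp: y_def)
  have "laplace f (of_real y) = of_real y * laplace I (of_real y)"
  proof (rule laplace_derivative[where S = "{t. exp t \<in> \<int>}" and x = y])
    show "continuous_on {0..} I" by (rule continuous_on_subset[OF I_continuous]) auto
    show "((\<lambda>t. I t * exp (- y * t)) \<longlongrightarrow> 0) at_top"
    proof (rule Lim_null_comparison)
      show "((\<lambda>t. exp (- (y - (2 + \<bar>\<kappa>\<bar>)) * t)) \<longlongrightarrow> 0) at_top"
        using y by (intro exp_minus_tendsto_0) auto
      show "\<forall>\<^sub>F t in at_top. norm (I t * exp (- y * t)) \<le> exp (- (y - (2 + \<bar>\<kappa>\<bar>)) * t)"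
        using eventually_ge_at_top[of 0]
      proof eventually_elim
        case (elim t)
        have "norm (I t * exp (- y * t)) \<le> 1 * exp ((2 + \<bar>\<kappa>\<bar>) * t) * exp (- y * t)"
          using I_bound[OF elim] by (simp add: abs_mult mult_right_mono)
        also have "\<dots> = exp (- (y - (2 + \<bar>\<kappa>\<bar>)) * t)" by (simp add: exp_add[symmetric] algebra_simps)
        finally show ?case .
      qed
    qed
  qed (use I_conv f_conv finite_exp_Ints I_deriv in \<open>auto simp: f_def I_def\<close>)
  also have "laplace f (of_real y) = laplace (\<lambda>t. mertens (exp t)) (of_real (x + 1 / 2))"
    unfolding f_def by (subst laplace_exp_mult) (simp add: y_def add.commute)
  also have "laplace I (of_real y) = laplace (\<lambda>t. normalized_integral \<kappa> (exp t)) (of_real x)"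
    unfolding normalized_integral_exp by (subst laplace_exp_mult) (simp add: y_def algebra_simps)
  finally have "of_real (x + 1 / 2) * (of_real y * laplace (\<lambda>t. normalized_integral \<kappa> (exp t)) (of_real x))
      * zeta (of_real (x + 1 / 2)) = 1"
    using laplace_mertens(2)[of "x + 1 / 2"] x by simp
  moreover have "zeta_reg (of_real (x + 1 / 2)) = (of_real x - 1 / 2) * zeta (of_real (x + 1 / 2))"
  proof -
    have "x + 1 / 2 \<noteq> 1" using x by linarith
    hence "complex_of_real (x + 1 / 2) \<noteq> 1" by (metis of_real_eq_1_iff)
    thus ?thesis by (simp add: zeta_reg_def)
  qed
  ultimately show "laplace (\<lambda>t. normalized_integral \<kappa> (exp t)) (of_real x) *
       ((of_real x + 1 / 2) * (of_real x + 3 / 2 - of_real \<kappa>) * zeta_reg (of_real x + 1 / 2)) = of_real x - 1 / 2"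
    by (simp add: y_def mult_ac)
qed

end

section \<open>Riesz products\<close>

text \<open>From T on the integrand g K e^(-\<delta>t) is nonnegative, while its integral over [0,T]
  is bounded uniformly in \<delta> and disappears after multiplication by \<delta>. The index set is
  abstract because different terms of an expanded product may have the same frequency.\<close>

lemma laplace_mean_nonneg:
  fixes g :: "real \<Rightarrow> real" and k m :: "'i \<Rightarrow> complex" and freq :: "'i \<Rightarrow> real" and K :: "real \<Rightarrow> real"
  assumes conv: "\<And>x. x > 0 \<Longrightarrow> laplace_conv g x"
    and T: "T \<ge> 0" "\<And>t. t \<ge> T \<Longrightarrow> g t \<ge> 0"
    and B: "\<And>t. t \<ge> 0 \<Longrightarrow> t \<le> T \<Longrightarrow> \<bar>g t\<bar> \<le> B"
    and E: "finite E"
    and K: "\<And>t. (\<Sum>i\<in>E. k i * exp (- (\<i> * freq i * t))) = of_real (K t)"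
    and K0: "\<And>t. K t \<ge> 0" and KM: "\<And>t. K t \<le> M"
    and lim: "\<And>i. i \<in> E \<Longrightarrow> ((\<lambda>\<delta>. of_real \<delta> * laplace g (of_real \<delta> + \<i> * freq i)) \<longlongrightarrow> m i) (at_right 0)"
  shows "Re (\<Sum>i\<in>E. k i * m i) \<ge> 0"
proof -
  have M: "M \<ge> 0" using K0[of 0] KM[of 0] by simp
  have B0: "B \<ge> 0" using B[of 0] T(1) by auto
  define \<Phi> where "\<Phi> = (\<lambda>\<delta>. Re (\<Sum>i\<in>E. k i * (of_real \<delta> * laplace g (of_real \<delta> + \<i> * freq i))))"
  have lower: "\<Phi> \<delta> \<ge> \<delta> * - (B * M * T)" if d: "\<delta> > 0" for \<delta>
  proof -
    define h where "h = (\<lambda>i t. indicator {0..} t *\<^sub>R (k i * (of_real (g t) * exp (- (of_real \<delta> + \<i> * freq i) * of_real t))))"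
    have int: "integrable lborel (h i)" for i
      unfolding h_def set_integrable_def[symmetric]
      by (intro set_integrable_mult_right laplace_integrable[OF conv[OF d]]) simp
    have h_int: "k i * laplace g (of_real \<delta> + \<i> * freq i) = (LINT t|lborel. h i t)" for i
      unfolding laplace_def h_def set_lebesgue_integral_def[symmetric] by (rule set_integral_mult_right[symmetric])
    have h_sum: "Re (\<Sum>i\<in>E. h i t) = indicator {0..} t * (g t * K t * exp (- \<delta> * t))" for t
    proof -
      have "(\<Sum>i\<in>E. h i t) = indicator {0..} t *\<^sub>R (of_real (g t * exp (- \<delta> * t)) * (\<Sum>i\<in>E. k i * exp (- (\<i> * freq i * t))))"
        by (auto simp: h_def scaleR_sum_right sum_distrib_left exp_of_real[symmetric] algebra_simps
           simp flip: exp_add intro!: sum.cong)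
      thus ?thesis by (simp add: K)
    qed
    have "(LINT t|lborel. - (B * M) * indicator {0..T} t) \<le> (LINT t|lborel. Re (\<Sum>i\<in>E. h i t))"
    proof (rule integral_mono)
      show "integrable lborel (\<lambda>t. - (B * M) * indicator {0..T} t)"
        by (intro integrable_mult_right integrable_real_indicator) (auto simp: emeasure_lborel_Icc_eq)
      show "integrable lborel (\<lambda>t. Re (\<Sum>i\<in>E. h i t))"
        by (intro integrable_Re Bochner_Integration.integrable_sum int)
      fix t :: real
      show "- (B * M) * indicator {0..T} t \<le> Re (\<Sum>i\<in>E. h i t)"
      proof (cases "t \<in> {0..T}")
        case True
        have "\<bar>g t * K t * exp (- \<delta> * t)\<bar> \<le> B * M * 1"
          unfolding abs_mult using True B[of t] K0[of t] KM[of t] d M B0 by (intro mult_mono) auto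
        thus ?thesis using True unfolding h_sum by simp
      next
        case False
        thus ?thesis using T(2)[of t] K0[of t] unfolding h_sum by (auto simp: indicator_def)
      qed
    qed
    also have "(LINT t|lborel. - (B * M) * indicator {0..T} t) = - (B * M * T)"
      using T(1) by (simp add: measure_def emeasure_lborel_Icc_eq)
    also have "(LINT t|lborel. Re (\<Sum>i\<in>E. h i t)) = Re (\<Sum>i\<in>E. LINT t|lborel. h i t)"
      using int by (subst integral_Re) (auto simp: Bochner_Integration.integral_sum)
    finally have "- (B * M * T) \<le> Re (\<Sum>i\<in>E. k i * laplace g (of_real \<delta> + \<i> * freq i))"
      by (simp only: h_int)
    hence "\<delta> * - (B * M * T) \<le> \<delta> * Re (\<Sum>i\<in>E. k i * laplace g (of_real \<delta> + \<i> * freq i))"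
      using d by (intro mult_left_mono) auto
    also have "\<dots> = \<Phi> \<delta>"
      unfolding \<Phi>_def by (simp add: Re_sum sum_distrib_left algebra_simps)
    finally show ?thesis .
  qed
  have "(\<Phi> \<longlongrightarrow> Re (\<Sum>i\<in>E. k i * m i)) (at_right 0)"
    unfolding \<Phi>_def by (intro tendsto_intros lim)
  moreover have "((\<lambda>\<delta>. \<delta> * - (B * M * T)) \<longlongrightarrow> 0 * - (B * M * T)) (at_right 0)"
    by (intro tendsto_intros)
  moreover have "eventually (\<lambda>\<delta>. \<delta> * - (B * M * T) \<le> \<Phi> \<delta>) (at_right 0)"
    using eventually_at_right_less[of 0] by eventually_elim (rule lower)
  ultimately show ?thesis using tendsto_le[OF trivial_limit_at_right_real] by fastforce
qed

text \<open>The kernel is the Riesz product \<open>\<Prod>(1 + 2 Re (z\<^sub>\<gamma> e\<^bsup>-i\<gamma>t\<^esup>))\<close>; expanding it leaves only the frequencies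
  \<open>0\<close> and \<open>\<plusminus>\<gamma>\<close>, as \<open>m\<close> vanishes at all longer combinations.\<close>

lemma riesz_product_mean:
  fixes g :: "real \<Rightarrow> real" and m z :: "real \<Rightarrow> complex"
  assumes conv: "\<And>x. x > 0 \<Longrightarrow> laplace_conv g x"
    and T: "T \<ge> 0" "\<And>t. t \<ge> T \<Longrightarrow> g t \<ge> 0"
    and B: "\<And>t. t \<ge> 0 \<Longrightarrow> t \<le> T \<Longrightarrow> \<bar>g t\<bar> \<le> B"
    and lim: "\<And>y. ((\<lambda>\<delta>. of_real \<delta> * laplace g (of_real \<delta> + \<i> * of_real y)) \<longlongrightarrow> m y) (at_right 0)"
    and G: "finite G" and z: "\<And>\<gamma>. norm (z \<gamma>) \<le> 1 / 2"
    and zero: "\<And>e :: real \<Rightarrow> int. (\<exists>\<gamma>1\<in>G. \<exists>\<gamma>2\<in>G. \<gamma>1 \<noteq> \<gamma>2 \<and> e \<gamma>1 \<noteq> 0 \<and> e \<gamma>2 \<noteq> 0) \<Longrightarrow> m (\<Sum>\<gamma>\<in>G. of_int (e \<gamma>) * \<gamma>) = 0"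
  shows "Re (m 0) + (\<Sum>\<gamma>\<in>G. Re (z \<gamma> * m \<gamma> + cnj (z \<gamma>) * m (- \<gamma>))) \<ge> 0"
proof -
  \<comment> \<open>The coefficient of exp(-i e \<gamma> t) in the factor for \<gamma>; an element
    of \<open>E\<close> picks one exponent from each factor.\<close>
  define c where "c = (\<lambda>\<gamma> e. if e = (0::int) then 1 else if e = 1 then z \<gamma> else cnj (z \<gamma>))"
  define E where "E = PiE G (\<lambda>_. {-1, 0, 1 :: int})"
  define k where "k = (\<lambda>e. \<Prod>\<gamma>\<in>G. c \<gamma> (e \<gamma>))"
  define freq where "freq = (\<lambda>e :: real \<Rightarrow> int. \<Sum>\<gamma>\<in>G. of_int (e \<gamma>) * \<gamma>)"
  define K where "K = (\<lambda>t. \<Prod>\<gamma>\<in>G. 1 + 2 * Re (z \<gamma> * exp (- (\<i> * \<gamma> * t))))"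
  have finE: "finite E" unfolding E_def by (intro finite_PiE G) auto
  \<comment> \<open>The bound 1/2 on |z| keeps every factor of \<open>K\<close> between 0 and 2, so
    the product is a nonnegative kernel, bounded by 2^|G|.\<close>
  have factor: "\<bar>2 * Re (z \<gamma> * exp (- (\<i> * \<gamma> * t)))\<bar> \<le> 1" for \<gamma> t :: real
  proof -
    have "\<bar>Re (z \<gamma> * exp (- (\<i> * \<gamma> * t)))\<bar> \<le> norm (z \<gamma> * exp (- (\<i> * \<gamma> * t)))" by (rule abs_Re_le_cmod)
    also have "\<dots> \<le> 1 / 2" using z[of \<gamma>] by (simp add: norm_mult)
    finally have "\<bar>Re (z \<gamma> * exp (- (\<i> * \<gamma> * t)))\<bar> \<le> 1 / 2" .
    moreover have "\<bar>2 * r\<bar> \<le> 1" if "\<bar>r\<bar> \<le> 1 / 2" for r :: real using that by auto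
    ultimately show ?thesis by blast
  qed
  have "Re (\<Sum>e\<in>E. k e * m (freq e)) \<ge> 0"
  proof (rule laplace_mean_nonneg[OF conv T B finE])
    fix t :: real
    have "(\<Prod>\<gamma>\<in>G. \<Sum>e\<in>{-1, 0, 1}. c \<gamma> e * exp (- (\<i> * (of_int e * \<gamma>) * t)))
       = (\<Sum>e\<in>E. \<Prod>\<gamma>\<in>G. c \<gamma> (e \<gamma>) * exp (- (\<i> * (of_int (e \<gamma>) * \<gamma>) * t)))"
      unfolding E_def by (rule prod_sum_PiE[OF G]) auto
    also have "\<dots> = (\<Sum>e\<in>E. k e * exp (- (\<i> * freq e * t)))"
    proof (intro sum.cong refl)
      fix e
      have "(\<Prod>\<gamma>\<in>G. exp (- (\<i> * (of_int (e \<gamma>) * \<gamma>) * t))) = exp (\<Sum>\<gamma>\<in>G. - (\<i> * (of_int (e \<gamma>) * \<gamma>) * t))"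
        using G by (simp add: exp_sum)
      also have "(\<Sum>\<gamma>\<in>G. - (\<i> * (of_int (e \<gamma>) * \<gamma>) * t)) = - (\<i> * freq e * t)"
        by (simp add: freq_def sum_distrib_left sum_distrib_right sum_negf)
      finally show "(\<Prod>\<gamma>\<in>G. c \<gamma> (e \<gamma>) * exp (- (\<i> * (of_int (e \<gamma>) * \<gamma>) * t))) = k e * exp (- (\<i> * freq e * t))"
        by (simp add: prod.distrib k_def)
    qed
    also have "(\<Prod>\<gamma>\<in>G. \<Sum>e\<in>{-1, 0, 1}. c \<gamma> e * exp (- (\<i> * (of_int e * \<gamma>) * t))) = of_real (K t)"
    proof -
      have "(\<Sum>e\<in>{-1, 0, 1}. c \<gamma> e * exp (- (\<i> * (of_int e * \<gamma>) * t))) = of_real (1 + 2 * Re (z \<gamma> * exp (- (\<i> * \<gamma> * t))))" for \<gamma> :: real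
      proof -
        have "cnj (z \<gamma>) * exp (\<i> * \<gamma> * t) = cnj (z \<gamma> * exp (- (\<i> * \<gamma> * t)))"
          by (simp add: exp_cnj)
        hence "(\<Sum>e\<in>{-1, 0, 1}. c \<gamma> e * exp (- (\<i> * (of_int e * \<gamma>) * t)))
           = 1 + (z \<gamma> * exp (- (\<i> * \<gamma> * t)) + cnj (z \<gamma> * exp (- (\<i> * \<gamma> * t))))"
          by (simp add: c_def)
        thus ?thesis by (simp only: complex_add_cnj) simp
      qed
      thus ?thesis by (simp add: K_def)
    qed
    finally show "(\<Sum>e\<in>E. k e * exp (- (\<i> * freq e * t))) = of_real (K t)" by simp
    have fac: "0 \<le> 1 + 2 * Re (z \<gamma> * exp (- (\<i> * \<gamma> * t)))" "1 + 2 * Re (z \<gamma> * exp (- (\<i> * \<gamma> * t))) \<le> 2" for \<gamma> :: real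
      using factor[of \<gamma> t] by (auto simp: abs_le_iff)
    show "K t \<ge> 0" unfolding K_def by (intro prod_nonneg fac)
    show "K t \<le> (\<Prod>\<gamma>\<in>G. 2)" unfolding K_def by (intro prod_mono conjI fac)
  qed (use lim in auto)
  also have "(\<Sum>e\<in>E. k e * m (freq e)) = m 0 + (\<Sum>\<gamma>\<in>G. z \<gamma> * m \<gamma> + cnj (z \<gamma>) * m (- \<gamma>))"
  proof -
    \<comment> \<open>Exponent vectors with one nonzero entry. They are restricted to
      \<open>G\<close>, like \<open>e0\<close>, in order to be elements of the extensional product
      \<open>E\<close>.\<close>
    define single where "single = (\<lambda>p. \<lambda>x\<in>G. if x = fst p then snd p else (0::int))"
    define e0 where "e0 = (\<lambda>x\<in>G. 0::int)"
    have inj: "inj_on single (G \<times> {1, -1})"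
    proof (rule inj_onI, clarify)
      fix a b :: real and i j :: int
      assume *: "a \<in> G" "b \<in> G" "i \<in> {1, -1}" "j \<in> {1, -1}" "single (a, i) = single (b, j)"
      from fun_cong[OF *(5), of a] * show "a = b \<and> i = j"
        by (auto simp: single_def split: if_splits)
    qed
    have e0: "e0 \<notin> single ` (G \<times> {1, -1})"
    proof
      assume "e0 \<in> single ` (G \<times> {1, -1})"
      then obtain a i where *: "a \<in> G" "i \<in> {1, -1}" "e0 = single (a, i)" by auto
      from fun_cong[OF *(3), of a] * show False by (auto simp: e0_def single_def)
    qed
    have "(\<Sum>e\<in>E. k e * m (freq e)) = (\<Sum>e\<in>insert e0 (single ` (G \<times> {1, -1})). k e * m (freq e))"
    proof (rule sum.mono_neutral_right[OF finE])
      show "insert e0 (single ` (G \<times> {1, -1})) \<subseteq> E"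
        by (auto simp: E_def e0_def single_def split: if_splits)
      show "\<forall>e\<in>E - insert e0 (single ` (G \<times> {1, -1})). k e * m (freq e) = 0"
      proof
        fix e assume e: "e \<in> E - insert e0 (single ` (G \<times> {1, -1}))"
        have ext: "e \<in> extensional G" and val: "\<And>x. x \<in> G \<Longrightarrow> e x \<in> {-1, 0, 1}"
          using e by (auto simp: E_def PiE_def)
        have "\<exists>a\<in>G. e a \<noteq> 0"
        proof (rule ccontr)
          assume "\<not> ?thesis"
          hence "e = e0" using ext by (intro extensionalityI[of _ G]) (auto simp: e0_def)
          thus False using e by auto
        qed
        then obtain a where a: "a \<in> G" "e a \<noteq> 0" by auto
        have "\<exists>b\<in>G. b \<noteq> a \<and> e b \<noteq> 0"
        proof (rule ccontr)
          assume "\<not> ?thesis"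
          hence "e = single (a, e a)" using ext a by (intro extensionalityI[of _ G]) (auto simp: single_def)
          moreover have "(a, e a) \<in> G \<times> {1, -1}" using a val[of a] by auto
          ultimately show False using e by blast
        qed
        thus "k e * m (freq e) = 0" using zero[of e] a by (auto simp: freq_def)
      qed
    qed
    also have "\<dots> = k e0 * m (freq e0) + (\<Sum>e\<in>single ` (G \<times> {1, -1}). k e * m (freq e))"
      using G e0 by (intro sum.insert) auto
    also have "k e0 * m (freq e0) = m 0"
      by (simp add: k_def e0_def freq_def c_def)
    also have "(\<Sum>e\<in>single ` (G \<times> {1, -1}). k e * m (freq e)) = (\<Sum>p\<in>G \<times> {1, -1}. k (single p) * m (freq (single p)))"
      using sum.reindex[OF inj] by simp
    also have "\<dots> = (\<Sum>p\<in>G \<times> {1, -1}. c (fst p) (snd p) * m (of_int (snd p) * fst p))"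
    proof (intro sum.cong refl)
      fix p :: "real \<times> int" assume p: "p \<in> G \<times> {1, -1}"
      have "k (single p) = (\<Prod>x\<in>G. if x = fst p then c x (snd p) else 1)"
        unfolding k_def by (intro prod.cong refl) (auto simp: single_def c_def)
      also have "\<dots> = c (fst p) (snd p)" using p G by (auto simp: prod.delta)
      finally have "k (single p) = c (fst p) (snd p)" .
      moreover have "freq (single p) = (\<Sum>x\<in>G. if x = fst p then of_int (snd p) * x else 0)"
        unfolding freq_def by (intro sum.cong refl) (auto simp: single_def)
      moreover have "\<dots> = of_int (snd p) * fst p" using p G by (auto simp: sum.delta)
      ultimately show "k (single p) * m (freq (single p)) = c (fst p) (snd p) * m (of_int (snd p) * fst p)" by simp
    qed
    also have "\<dots> = (\<Sum>\<gamma>\<in>G. \<Sum>i\<in>{1, -1}. c \<gamma> i * m (of_int i * \<gamma>))"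
      by (simp only: sum.cartesian_product case_prod_unfold)
    also have "\<dots> = (\<Sum>\<gamma>\<in>G. z \<gamma> * m \<gamma> + cnj (z \<gamma>) * m (- \<gamma>))"
      by (intro sum.cong refl) (simp add: c_def)
    finally show ?thesis .
  qed
  finally show ?thesis by (simp add: Re_sum)
qed

section \<open>Boundary behaviour of a quotient transform\<close>

lemma laplace_cnj: "laplace f (cnj s) = cnj (laplace f s)"
  unfolding laplace_def set_lebesgue_integral_def
  by (subst Bochner_Integration.integral_cnj[symmetric]) (simp add: exp_cnj)

text \<open>Absolute values inside the integral remove the oscillation. Consequently a pole
  elsewhere on the boundary line cannot have higher order than the behaviour at the real point
  allows.\<close>

lemma norm_laplace_le:
  assumes "laplace_conv f (Re s)" "\<And>t. t \<ge> 0 \<Longrightarrow> f t \<ge> 0"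
  shows "norm (laplace f s) \<le> norm (laplace f (of_real (Re s)))"
proof -
  have "norm (laplace f s) \<le> (LINT t|lborel. norm (indicator {0..} t *\<^sub>R (of_real (f t) * exp (- s * of_real t))))"
    unfolding laplace_def set_lebesgue_integral_def by (rule integral_norm_bound)
  also have "\<dots> = (LINT t:{0..}|lborel. f t * exp (- Re s * t))"
    unfolding set_lebesgue_integral_def
    by (intro Bochner_Integration.integral_cong) (auto simp: indicator_def norm_mult assms(2))
  also have "\<dots> \<le> norm (laplace f (of_real (Re s)))"
    by (simp add: laplace_of_real)
  finally show ?thesis .
qed

context
  fixes L Q R :: "complex \<Rightarrow> complex" and y :: real
  assumes Q: "Q holomorphic_on UNIV" and R: "R holomorphic_on UNIV"
    and eq: "\<And>s. Re s > 0 \<Longrightarrow> L s * Q s = R s"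
begin

private lemma shift_tendsto: "((\<lambda>\<delta>. of_real \<delta> + \<i> * of_real y) \<longlongrightarrow> \<i> * of_real y) (at_right 0)"
proof -
  have "((\<lambda>\<delta>. of_real \<delta> + \<i> * of_real y) \<longlongrightarrow> of_real 0 + \<i> * of_real y) (at_right 0)"
    by (intro tendsto_intros)
  thus ?thesis by simp
qed

private lemma holomorphic_shift_tendsto:
  assumes "f holomorphic_on UNIV"
  shows "((\<lambda>\<delta>. f (of_real \<delta> + \<i> * of_real y)) \<longlongrightarrow> f (\<i> * of_real y)) (at_right 0)"
proof -
  have "isCont f (\<i> * of_real y)"
    using assms by (auto intro: holomorphic_on_imp_continuous_on continuous_on_interior)
  thus ?thesis using shift_tendsto by (rule isCont_tendsto_compose)
qed

lemma laplace_limit_regular: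
  assumes "Q (\<i> * of_real y) \<noteq> 0"
  shows "((\<lambda>\<delta>. of_real \<delta> * L (of_real \<delta> + \<i> * of_real y)) \<longlongrightarrow> 0) (at_right 0)"
proof (rule Lim_transform_eventually)
  have "((\<lambda>\<delta>. of_real \<delta> * (R (of_real \<delta> + \<i> * of_real y) / Q (of_real \<delta> + \<i> * of_real y)))
      \<longlongrightarrow> of_real 0 * (R (\<i> * of_real y) / Q (\<i> * of_real y))) (at_right 0)"
    by (intro tendsto_intros holomorphic_shift_tendsto Q R assms)
  thus "((\<lambda>\<delta>. of_real \<delta> * (R (of_real \<delta> + \<i> * of_real y) / Q (of_real \<delta> + \<i> * of_real y))) \<longlongrightarrow> 0) (at_right 0)"
    by simp
  have "eventually (\<lambda>\<delta>. Q (of_real \<delta> + \<i> * of_real y) \<noteq> 0) (at_right 0)"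
    by (rule tendsto_imp_eventually_ne[OF holomorphic_shift_tendsto[OF Q] assms])
  thus "eventually (\<lambda>\<delta>. of_real \<delta> * (R (of_real \<delta> + \<i> * of_real y) / Q (of_real \<delta> + \<i> * of_real y))
      = of_real \<delta> * L (of_real \<delta> + \<i> * of_real y)) (at_right 0)"
    using eventually_at_right_less[of 0]
  proof eventually_elim
    case (elim \<delta>)
    thus ?case using eq[of "of_real \<delta> + \<i> * of_real y"] by (simp add: nonzero_divide_eq_eq flip: eq)
  qed
qed

lemma difference_quotient_tendsto:
  assumes "Q (\<i> * of_real y) = 0"
  shows "((\<lambda>\<delta>. Q (of_real \<delta> + \<i> * of_real y) / of_real \<delta>) \<longlongrightarrow> deriv Q (\<i> * of_real y)) (at_right 0)"
proof -
  have "(Q has_field_derivative deriv Q (\<i> * of_real y)) (at (\<i> * of_real y))"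
    using Q by (auto intro: holomorphic_derivI)
  hence lim: "((\<lambda>h. (Q (\<i> * of_real y + h) - Q (\<i> * of_real y)) / h) \<longlongrightarrow> deriv Q (\<i> * of_real y)) (at 0)"
    by (simp add: DERIV_def)
  have "filterlim (\<lambda>\<delta>::real. complex_of_real \<delta>) (at 0) (at_right 0)"
  proof (rule filterlim_atI)
    have "((\<lambda>\<delta>. complex_of_real \<delta>) \<longlongrightarrow> of_real 0) (at_right 0)" by (intro tendsto_intros)
    thus "((\<lambda>\<delta>. complex_of_real \<delta>) \<longlongrightarrow> 0) (at_right 0)" by simp
    show "eventually (\<lambda>\<delta>. complex_of_real \<delta> \<noteq> 0) (at_right 0)"
      using eventually_at_right_less[of "0::real"] by eventually_elim auto
  qed
  from filterlim_compose[OF lim this] show ?thesis by (simp add: assms add.commute)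
qed

text \<open>Written as R / (Q / \<delta>), the expression has a difference quotient of
  \<open>Q\<close> as its denominator.\<close>

lemma laplace_limit_pole:
  assumes "Q (\<i> * of_real y) = 0" "deriv Q (\<i> * of_real y) \<noteq> 0"
  shows "((\<lambda>\<delta>. of_real \<delta> * L (of_real \<delta> + \<i> * of_real y)) \<longlongrightarrow> R (\<i> * of_real y) / deriv Q (\<i> * of_real y)) (at_right 0)"
proof (rule Lim_transform_eventually)
  note lim = difference_quotient_tendsto[OF assms(1)]
  show "((\<lambda>\<delta>. R (of_real \<delta> + \<i> * of_real y) / (Q (of_real \<delta> + \<i> * of_real y) / of_real \<delta>))
      \<longlongrightarrow> R (\<i> * of_real y) / deriv Q (\<i> * of_real y)) (at_right 0)"
    by (intro tendsto_divide lim holomorphic_shift_tendsto R assms)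
  have "eventually (\<lambda>\<delta>. Q (of_real \<delta> + \<i> * of_real y) / of_real \<delta> \<noteq> 0) (at_right 0)"
    by (rule tendsto_imp_eventually_ne[OF lim assms(2)])
  thus "eventually (\<lambda>\<delta>. R (of_real \<delta> + \<i> * of_real y) / (Q (of_real \<delta> + \<i> * of_real y) / of_real \<delta>)
      = of_real \<delta> * L (of_real \<delta> + \<i> * of_real y)) (at_right 0)"
    using eventually_at_right_less[of 0]
  proof eventually_elim
    case (elim \<delta>)
    hence "Q (of_real \<delta> + \<i> * of_real y) \<noteq> 0" by auto
    thus ?case using eq[of "of_real \<delta> + \<i> * of_real y"] elim by (simp flip: eq)
  qed
qed

text \<open>At a multiple pole \<open>\<delta> L(\<delta> + iy)\<close> would be unbounded.\<close>

lemma deriv_nonzero_of_bounded: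
  assumes "Q (\<i> * of_real y) = 0" "R (\<i> * of_real y) \<noteq> 0"
    and "eventually (\<lambda>\<delta>. norm (of_real \<delta> * L (of_real \<delta> + \<i> * of_real y)) \<le> B) (at_right 0)"
  shows "deriv Q (\<i> * of_real y) \<noteq> 0"
proof
  assume "deriv Q (\<i> * of_real y) = 0"
  hence "((\<lambda>\<delta>. B * norm (Q (of_real \<delta> + \<i> * of_real y) / of_real \<delta>)) \<longlongrightarrow> B * norm (0 :: complex)) (at_right 0)"
    using difference_quotient_tendsto[OF assms(1)] by (intro tendsto_intros) simp
  moreover have "((\<lambda>\<delta>. norm (R (of_real \<delta> + \<i> * of_real y))) \<longlongrightarrow> norm (R (\<i> * of_real y))) (at_right 0)"
    by (intro tendsto_intros holomorphic_shift_tendsto R)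
  moreover have "eventually (\<lambda>\<delta>. norm (R (of_real \<delta> + \<i> * of_real y))
      \<le> B * norm (Q (of_real \<delta> + \<i> * of_real y) / of_real \<delta>)) (at_right 0)"
    using assms(3) eventually_at_right_less[of 0]
  proof eventually_elim
    case (elim \<delta>)
    let ?s = "of_real \<delta> + \<i> * of_real y"
    \<comment> \<open>As \<delta> tends to 0 the left side has a nonzero limit; on the right the
      first factor is bounded, and a vanishing derivative would send the second to 0.\<close>
    have "R ?s = (of_real \<delta> * L ?s) * (Q ?s / of_real \<delta>)" using elim by (simp flip: eq)
    thus ?case using mult_right_mono[OF elim(1) norm_ge_zero[of "Q ?s / of_real \<delta>"]] by (simp only: norm_mult)
  qed
  ultimately have "norm (R (\<i> * of_real y)) \<le> B * norm (0 :: complex)"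
    by (rule tendsto_le[OF trivial_limit_at_right_real])
  thus False using assms(2) by simp
qed

end

text \<open>A zero of \<open>Q\<close> at 0, if any, is assumed simple, since the other poles on the
  imaginary axis are shown to be simple by comparison with 0. \<open>R_nonzero\<close> prevents a
  zero of \<open>Q\<close> on that axis from being cancelled.\<close>

locale laplace_quotient =
  fixes A :: "real \<Rightarrow> real" and Q R :: "complex \<Rightarrow> complex" and d C T :: real
  assumes A_cont: "continuous_on UNIV A" and A_conv: "\<And>x. x > d \<Longrightarrow> laplace_conv A x"
    and Q_hol: "Q holomorphic_on UNIV" and R_hol: "R holomorphic_on UNIV"
    and quotient: "\<And>x. x > d \<Longrightarrow> laplace A (of_real x) * Q (of_real x) = R (of_real x)"
    and Q_nonzero: "\<And>x. x > 0 \<Longrightarrow> Q (of_real x) \<noteq> 0"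
    and Q_0: "Q 0 = 0 \<Longrightarrow> deriv Q 0 \<noteq> 0"
    and R_nonzero: "\<And>y. R (\<i> * of_real y) \<noteq> 0"
    and T: "T \<ge> 0" and A_le: "\<And>t. t \<ge> T \<Longrightarrow> A t \<le> C"
begin

text \<open>The limit of \<delta> times the transform at \<delta> + iy, hence 0 at points that are
  not poles.\<close>

definition residue_at :: "real \<Rightarrow> complex" where
  "residue_at y = (if Q (\<i> * of_real y) = 0 then R (\<i> * of_real y) / deriv Q (\<i> * of_real y) else 0)"

lemma const_conv: "x > 0 \<Longrightarrow> laplace_conv (\<lambda>_. c) x"
  using laplace_conv_cmult[OF laplace_conv_1, of x c] by simp

lemma laplace_const: "Re s > 0 \<Longrightarrow> laplace (\<lambda>_. c) s = of_real c / s"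
  using laplace_cmult[of c "\<lambda>_. 1" s] by (simp add: laplace_1)

lemma A_bounded: "\<exists>B. \<forall>t. 0 \<le> t \<and> t \<le> b \<longrightarrow> \<bar>A t\<bar> \<le> B"
proof -
  have "compact (A ` {0..b})"
    by (intro compact_continuous_image continuous_on_subset[OF A_cont]) auto
  then obtain B where "\<forall>x\<in>A ` {0..b}. norm x \<le> B"
    using compact_imp_bounded bounded_iff by blast
  thus ?thesis by (intro exI[of _ B]) auto
qed

text \<open>Landau's theorem needs a sign on the whole half-line, so the bound is extended over
  [0,T] by compactness. \<open>D\<close> may exceed \<open>C\<close>, which is kept for the final
  inequality.\<close>

lemma A_le_everywhere: obtains D where "\<And>t. t \<ge> 0 \<Longrightarrow> A t \<le> D"
proof -
  obtain B where B: "\<And>t. 0 \<le> t \<Longrightarrow> t \<le> T \<Longrightarrow> \<bar>A t\<bar> \<le> B" using A_bounded by blast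
  have "A t \<le> max B C" if "t \<ge> 0" for t
    using B[of t] A_le[of t] that by (cases "t \<le> T") (auto simp: max_def)
  thus thesis by (rule that)
qed

lemma conv: assumes "x > 0" shows "laplace_conv A x"
proof -
  obtain D where D: "\<And>t. t \<ge> 0 \<Longrightarrow> A t \<le> D" using A_le_everywhere by blast
  define d' where "d' = max d 0"
  have conv_d: "laplace_conv (\<lambda>t. D - A t) x" if "x > d'" for x
    using that by (intro laplace_conv_diff const_conv A_conv) (auto simp: d'_def)
  have "laplace_conv (\<lambda>t. D - A t) x"
  \<comment> \<open>The transform of D - A is D/s - R(s)/Q(s); multiplying by s Q(s), which has no
    positive real zero, gives the entire pair.\<close>
  proof (rule laplace_conv_landau[where Q = "\<lambda>s. s * Q s" and R = "\<lambda>s. of_real D * Q s - s * R s" and c = "d' + 1" and d = d'])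
    fix x assume x: "x > d'"
    have "laplace (\<lambda>t. D - A t) (of_real x) = of_real D / of_real x - laplace A (of_real x)"
      using x by (subst laplace_diff) (auto simp: d'_def laplace_const intro!: const_conv A_conv)
    thus "laplace (\<lambda>t. D - A t) (of_real x) * (of_real x * Q (of_real x)) = of_real D * Q (of_real x) - of_real x * R (of_real x)"
      using x quotient[of x] by (simp add: d'_def left_diff_distrib right_diff_distrib mult.left_commute[of _ "of_real x"])
  qed (use D Q_nonzero assms in \<open>auto intro!: holomorphic_intros Q_hol R_hol conv_d\<close>)
  from laplace_conv_diff[OF const_conv[OF assms, of D] this] show ?thesis by simp
qed

lemma quotient_halfplane: "Re s > 0 \<Longrightarrow> laplace A s * Q s = R s"
  by (rule laplace_eq_on_halfplane[where c = 0 and d = d])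
     (auto intro: conv quotient holomorphic_on_subset[OF Q_hol] holomorphic_on_subset[OF R_hol])

text \<open>Away from y = 0 the transform of D - A at \<delta> + iy is dominated by its value at
  \<delta>, and \<delta> times the latter converges because a pole at 0 is simple. So \<delta> times
  the transform of \<open>A\<close> at \<delta> + iy stays bounded.\<close>

lemma simple_pole: assumes "Q (\<i> * of_real y) = 0" shows "deriv Q (\<i> * of_real y) \<noteq> 0"
proof (cases "y = 0")
  case True
  thus ?thesis using Q_0 assms by simp
next
  case False
  obtain D where D: "\<And>t. t \<ge> 0 \<Longrightarrow> A t \<le> D" using A_le_everywhere by blast
  have convD: "laplace_conv (\<lambda>t. D - A t) x" if "x > 0" for x
    using that by (intro laplace_conv_diff const_conv conv)
  have lap: "laplace (\<lambda>t. D - A t) s = of_real D / s - laplace A s" if "Re s > 0" for s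
    using that by (subst laplace_diff) (auto simp: laplace_const intro!: const_conv conv)
  have "\<exists>l. ((\<lambda>\<delta>. of_real \<delta> * laplace A (of_real \<delta> + \<i> * of_real 0)) \<longlongrightarrow> l) (at_right 0)"
    using laplace_limit_regular[OF Q_hol R_hol quotient_halfplane, of 0]
      laplace_limit_pole[OF Q_hol R_hol quotient_halfplane, of 0] Q_0 by (cases "Q 0 = 0") auto
  then obtain l where "((\<lambda>\<delta>. of_real \<delta> * laplace A (of_real \<delta>)) \<longlongrightarrow> l) (at_right 0)" by auto
  hence "((\<lambda>\<delta>. norm (of_real D - of_real \<delta> * laplace A (of_real \<delta>))) \<longlongrightarrow> norm (of_real D - l)) (at_right 0)"
    by (intro tendsto_intros)
  hence ev: "eventually (\<lambda>\<delta>. norm (of_real D - of_real \<delta> * laplace A (of_real \<delta>)) < norm (of_real D - l) + 1) (at_right 0)"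
    by (rule order_tendstoD) simp
  show ?thesis
  proof (rule deriv_nonzero_of_bounded[OF Q_hol R_hol quotient_halfplane assms R_nonzero])
    show "\<forall>\<^sub>F \<delta> in at_right 0. norm (of_real \<delta> * laplace A (of_real \<delta> + \<i> * of_real y)) \<le> (norm (of_real D - l) + 1) + \<bar>D\<bar>"
      using ev eventually_at_right_less[of 0]
    proof eventually_elim
      case (elim \<delta>)
      let ?s = "of_real \<delta> + \<i> * of_real y"
      have s: "Re ?s = \<delta>" "?s \<noteq> 0" using elim by (auto simp: complex_eq_iff)
      have "laplace A ?s = of_real D / ?s - laplace (\<lambda>t. D - A t) ?s" using elim by (subst lap) auto
      from arg_cong[OF this, of "\<lambda>w. of_real \<delta> * w"]
      have "of_real \<delta> * laplace A ?s = of_real D * (of_real \<delta> / ?s) - of_real \<delta> * laplace (\<lambda>t. D - A t) ?s"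
        by (simp add: right_diff_distrib)
      also have "norm \<dots> \<le> norm (of_real D * (of_real \<delta> / ?s)) + norm (of_real \<delta> * laplace (\<lambda>t. D - A t) ?s)"
        by (rule norm_triangle_ineq4)
      also have "norm (of_real D * (of_real \<delta> / ?s)) \<le> \<bar>D\<bar> * 1"
      proof -
        have "\<delta> \<le> norm ?s" using complex_Re_le_cmod[of ?s] by simp
        hence "norm (of_real \<delta> / ?s) \<le> 1" using elim s by (simp add: norm_divide divide_le_eq)
        thus ?thesis unfolding norm_mult by (intro mult_mono) auto
      qed
      also have "norm (of_real \<delta> * laplace (\<lambda>t. D - A t) ?s) \<le> norm (of_real \<delta> * laplace (\<lambda>t. D - A t) (of_real \<delta>))"
        unfolding norm_mult using norm_laplace_le[of "\<lambda>t. D - A t" ?s] D convD elim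
        by (intro mult_left_mono) auto
      also have "of_real \<delta> * laplace (\<lambda>t. D - A t) (of_real \<delta>) = of_real D - of_real \<delta> * laplace A (of_real \<delta>)"
        using elim by (subst lap) (auto simp: right_diff_distrib)
      finally show ?case using elim by simp
    qed
  qed
qed

lemma limit: "((\<lambda>\<delta>. of_real \<delta> * laplace A (of_real \<delta> + \<i> * of_real y)) \<longlongrightarrow> residue_at y) (at_right 0)"
  unfolding residue_at_def
  using laplace_limit_regular[OF Q_hol R_hol quotient_halfplane]
    laplace_limit_pole[OF Q_hol R_hol quotient_halfplane _ simple_pole] by auto

lemma residue_at_minus: "residue_at (- y) = cnj (residue_at y)"
proof (rule tendsto_unique[OF trivial_limit_at_right_real limit])
  have "((\<lambda>\<delta>. cnj (of_real \<delta> * laplace A (of_real \<delta> + \<i> * of_real y))) \<longlongrightarrow> cnj (residue_at y)) (at_right 0)"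
    by (intro tendsto_cnj limit)
  thus "((\<lambda>\<delta>. of_real \<delta> * laplace A (of_real \<delta> + \<i> * of_real (- y))) \<longlongrightarrow> cnj (residue_at y)) (at_right 0)"
    by (simp flip: laplace_cnj)
qed

theorem sum_residues_le:
  assumes G: "finite G" "0 \<notin> G"
    and indep: "\<And>e :: real \<Rightarrow> int. (\<exists>\<gamma>1\<in>G. \<exists>\<gamma>2\<in>G. \<gamma>1 \<noteq> \<gamma>2 \<and> e \<gamma>1 \<noteq> 0 \<and> e \<gamma>2 \<noteq> 0)
      \<Longrightarrow> (\<Sum>\<gamma>\<in>G. of_int (e \<gamma>) * \<gamma>) \<noteq> 0 \<and> Q (\<i> * of_real (\<Sum>\<gamma>\<in>G. of_int (e \<gamma>) * \<gamma>)) \<noteq> 0"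
  shows "Re (residue_at 0) + (\<Sum>\<gamma>\<in>G. norm (residue_at \<gamma>)) \<le> C"
proof -
  define g where "g = (\<lambda>t. C - A t)"
  \<comment> \<open>The limits belonging to C - A: the constant has a pole only at 0, with residue
    C.\<close>
  define m where "m = (\<lambda>y. (if y = 0 then of_real C else 0) - residue_at y)"
  \<comment> \<open>The phase makes z times the residue equal to half its modulus, the largest value
    that |z| \<le> 1/2 permits. If the residue vanishes, division by zero gives z = 0.\<close>
  define z where "z = (\<lambda>y. cnj (residue_at y) / of_real (2 * norm (residue_at y)))"
  obtain B where B: "\<And>t. 0 \<le> t \<Longrightarrow> t \<le> T \<Longrightarrow> \<bar>A t\<bar> \<le> B" using A_bounded by blast
  have "Re (m 0) + (\<Sum>\<gamma>\<in>G. Re (z \<gamma> * m \<gamma> + cnj (z \<gamma>) * m (- \<gamma>))) \<ge> 0"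
  proof (rule riesz_product_mean[where g = g and T = T and B = "\<bar>C\<bar> + B"])
    show "laplace_conv g x" if "x > 0" for x unfolding g_def using that by (intro laplace_conv_diff const_conv conv)
    show "((\<lambda>\<delta>. of_real \<delta> * laplace g (of_real \<delta> + \<i> * of_real y)) \<longlongrightarrow> m y) (at_right 0)" for y
    proof (rule Lim_transform_eventually)
      have "((\<lambda>\<delta>. of_real C * (of_real \<delta> / (of_real \<delta> + \<i> * of_real y))) \<longlongrightarrow> (if y = 0 then of_real C else 0)) (at_right 0)"
      proof (cases "y = 0")
        case True
        have "eventually (\<lambda>\<delta>. of_real C = of_real C * (of_real \<delta> / (of_real \<delta> + \<i> * of_real y))) (at_right 0)"
          using eventually_at_right_less[of "0::real"] by eventually_elim (simp add: True)
        thus ?thesis using True by (auto intro: Lim_transform_eventually[OF tendsto_const])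
      next
        case False
        have "((\<lambda>\<delta>. of_real C * (of_real \<delta> / (of_real \<delta> + \<i> * of_real y)))
            \<longlongrightarrow> of_real C * (of_real 0 / (of_real 0 + \<i> * of_real y))) (at_right 0)"
          using False by (intro tendsto_intros) auto
        thus ?thesis using False by simp
      qed
      thus "((\<lambda>\<delta>. of_real C * (of_real \<delta> / (of_real \<delta> + \<i> * of_real y)) - of_real \<delta> * laplace A (of_real \<delta> + \<i> * of_real y)) \<longlongrightarrow> m y) (at_right 0)"
        unfolding m_def by (intro tendsto_diff limit)
      show "eventually (\<lambda>\<delta>. of_real C * (of_real \<delta> / (of_real \<delta> + \<i> * of_real y)) - of_real \<delta> * laplace A (of_real \<delta> + \<i> * of_real y)
          = of_real \<delta> * laplace g (of_real \<delta> + \<i> * of_real y)) (at_right 0)"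
        using eventually_at_right_less[of 0]
      proof eventually_elim
        case (elim \<delta>)
        thus ?case unfolding g_def
          by (subst laplace_diff) (auto simp: laplace_const algebra_simps intro!: const_conv conv)
      qed
    qed
    show "norm (z \<gamma>) \<le> 1 / 2" for \<gamma> by (simp add: z_def norm_divide)
    show "m (\<Sum>\<gamma>\<in>G. of_int (e \<gamma>) * \<gamma>) = 0"
      if "\<exists>\<gamma>1\<in>G. \<exists>\<gamma>2\<in>G. \<gamma>1 \<noteq> \<gamma>2 \<and> e \<gamma>1 \<noteq> 0 \<and> e \<gamma>2 \<noteq> 0" for e :: "real \<Rightarrow> int"
      using indep[OF that] by (simp add: m_def residue_at_def)
    show "g t \<ge> 0" if "t \<ge> T" for t using A_le[OF that] by (simp add: g_def)
    show "\<bar>g t\<bar> \<le> \<bar>C\<bar> + B" if "t \<ge> 0" "t \<le> T" for t using B[OF that] by (simp add: g_def)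
  qed (use T G in auto)
  moreover have "Re (z \<gamma> * m \<gamma> + cnj (z \<gamma>) * m (- \<gamma>)) = - norm (residue_at \<gamma>)" if "\<gamma> \<in> G" for \<gamma>
  proof -
    let ?r = "residue_at \<gamma>"
    have *: "z \<gamma> * ?r = of_real (norm ?r / 2)"
    proof (cases "?r = 0")
      case False
      have "cnj ?r * ?r = of_real (norm ?r ^ 2)" by (metis complex_norm_square mult.commute)
      thus ?thesis using False by (simp add: z_def power2_eq_square)
    qed simp
    have "m \<gamma> = - ?r" "m (- \<gamma>) = - cnj ?r"
      using that G by (auto simp: m_def residue_at_minus)
    hence "z \<gamma> * m \<gamma> + cnj (z \<gamma>) * m (- \<gamma>) = - (z \<gamma> * ?r) - cnj (z \<gamma> * ?r)" by simp
    thus ?thesis unfolding * by simp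
  qed
  ultimately show ?thesis by (simp add: m_def sum_negf)
qed

end

section \<open>Zeros and ordinates\<close>

lemma zeta_reg_eq: "s \<noteq> 1 \<Longrightarrow> zeta_reg s = (s - 1) * zeta s"
  by (simp add: zeta_reg_def)

lemma deriv_zeta_reg_at_zero:
  assumes "s \<noteq> 1" "zeta s = 0"
  shows "deriv zeta_reg s = (s - 1) * deriv zeta s"
proof -
  have "(zeta has_field_derivative deriv zeta s) (at s)"
    using assms(1) by (intro holomorphic_derivI[OF zeta_holomorphic]) auto
  hence "((\<lambda>s. (s - 1) * zeta s) has_field_derivative (s - 1) * deriv zeta s) (at s)"
    using assms(2) by (auto intro!: derivative_eq_intros)
  hence "(zeta_reg has_field_derivative (s - 1) * deriv zeta s) (at s)"
    by (rule has_field_derivative_transform_within_open[of _ _ _ "- {1}"]) (use assms(1) in \<open>auto simp: zeta_reg_eq\<close>)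
  thus ?thesis by (rule DERIV_imp_deriv)
qed

lemma riemann_hypothesis_zeros:
  assumes "riemann_hypothesis" "\<rho> \<in> nontrivial_zeros"
  shows "\<rho> = 1 / 2 + \<i> * of_real (Im \<rho>)" "Im \<rho> \<noteq> 0" "\<rho> \<noteq> 1" "zeta \<rho> = 0"
proof -
  have Re: "Re \<rho> = 1 / 2" using assms by (auto simp: riemann_hypothesis_def)
  thus *: "\<rho> = 1 / 2 + \<i> * of_real (Im \<rho>)" by (simp add: complex_eq_iff)
  show ne: "\<rho> \<noteq> 1" using Re by auto
  show zeta: "zeta \<rho> = 0" using assms(2) by (simp add: nontrivial_zeros_def)
  show "Im \<rho> \<noteq> 0"
  proof
    assume "Im \<rho> = 0"
    hence half: "\<rho> = of_real (1 / 2)" using * by simp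
    have "zeta_reg \<rho> = 0" using zeta_reg_eq[OF ne] zeta by simp
    hence "zeta_reg (of_real (1 / 2)) = 0" unfolding half .
    thus False using zeta_reg_real_pos(2)[of "1 / 2"] by simp
  qed
qed

lemma zeta_reg_zero_on_line:
  assumes "zeta_reg (1 / 2 + \<i> * of_real y) = 0"
  shows "1 / 2 + \<i> * of_real y \<in> nontrivial_zeros"
proof -
  have "1 / 2 + \<i> * of_real y \<noteq> 1" by (simp add: complex_eq_iff)
  hence "zeta (1 / 2 + \<i> * of_real y) = 0"
    using assms by (metis mult_eq_0_iff right_minus_eq zeta_reg_eq)
  thus ?thesis by (simp add: nontrivial_zeros_def)
qed

definition positive_ordinates :: "real set" where
  "positive_ordinates = {\<gamma>. \<gamma> > 0 \<and> (\<exists>\<rho>\<in>nontrivial_zeros. \<gamma> = Im \<rho>)}"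

text \<open>Conjugation reduces negative y to positive, and positivity of \<open>zeta_reg\<close> at
  1/2 rules out y = 0.\<close>

lemma zeta_reg_zero_ordinate:
  assumes "zeta_reg (1 / 2 + \<i> * of_real y) = 0"
  shows "\<bar>y\<bar> \<in> positive_ordinates"
proof -
  have *: "\<bar>y\<bar> \<in> positive_ordinates" if "zeta_reg (1 / 2 + \<i> * of_real y) = 0" "y > 0" for y
    using zeta_reg_zero_on_line[OF that(1)] that(2) by (force simp: positive_ordinates_def)
  consider "y > 0" | "y = 0" | "y < 0" by linarith
  thus ?thesis
  proof cases
    case 1 thus ?thesis using * assms by blast
  next
    case 2 thus ?thesis using assms zeta_reg_real_pos(2)[of "1 / 2"] by simp
  next
    case 3
    have "zeta_reg (cnj (1 / 2 + \<i> * of_real y)) = 0" using assms by (simp only: zeta_reg_cnj complex_cnj_zero)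
    thus ?thesis using *[of "- y"] 3 by simp
  qed
qed

lemma vector_space_rat_real: "vector_space (\<lambda>(q :: rat) x. real_of_rat q * x)"
  by unfold_locales (auto simp: algebra_simps of_rat_add of_rat_mult)

lemma int_combination_zero:
  fixes u :: "real \<Rightarrow> int"
  assumes "linear_independence_conjecture" "finite S" "S \<subseteq> positive_ordinates"
    and "(\<Sum>v\<in>S. of_int (u v) * v) = 0" "v \<in> S"
  shows "u v = 0"
proof -
  interpret vector_space "\<lambda>(q :: rat) x. real_of_rat q * x" by (rule vector_space_rat_real)
  have "independent positive_ordinates"
    using assms(1) by (simp add: linear_independence_conjecture_def positive_ordinates_def)
  from independentD[OF this assms(2,3), of "\<lambda>v. of_int (u v)" v] assms(4,5) show ?thesis by simp
qed

text \<open>The sign \<sigma> treats both limits at once: for \<sigma> = 1 the assumption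
  \<open>le\<close> comes from a bound on the upper limit, for \<sigma> = -1 from one on the lower
  limit.\<close>

context
  fixes \<kappa> \<sigma> C T :: real
  assumes lic: "linear_independence_conjecture" and kappa: "\<kappa> \<le> 3 / 2" and sign: "\<bar>\<sigma>\<bar> = 1"
    and T: "T \<ge> 0" and le: "\<And>t. t \<ge> T \<Longrightarrow> \<sigma> * normalized_integral \<kappa> (exp t) \<le> C"
begin

private lemma rh: "riemann_hypothesis" using lic by (simp add: linear_independence_conjecture_def)

text \<open>With w = s + 1/2 this is w (w - \<kappa> + 1)(w - 1) zeta(w). The factor w - 1 makes it
  entire and reappears as s - 1/2 in \<open>R\<close>.\<close>

private definition Q :: "complex \<Rightarrow> complex" where
  "Q s = (s + 1 / 2) * (s + 3 / 2 - of_real \<kappa>) * zeta_reg (s + 1 / 2)"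

private definition R :: "complex \<Rightarrow> complex" where "R s = of_real \<sigma> * (s - 1 / 2)"

private definition A :: "real \<Rightarrow> real" where "A t = \<sigma> * normalized_integral \<kappa> (exp t)"

private lemma Q_derivative:
  "deriv Q s = ((s + 3 / 2 - of_real \<kappa>) + (s + 1 / 2)) * zeta_reg (s + 1 / 2)
      + (s + 1 / 2) * (s + 3 / 2 - of_real \<kappa>) * deriv zeta_reg (s + 1 / 2)"
proof -
  have "(zeta_reg has_field_derivative deriv zeta_reg (s + 1 / 2)) (at (s + 1 / 2))"
    by (intro holomorphic_derivI[OF zeta_reg_holomorphic]) auto
  hence "((\<lambda>s. zeta_reg (s + 1 / 2)) has_field_derivative deriv zeta_reg (s + 1 / 2) * 1) (at s)"
    by (rule DERIV_chain2[where g = "\<lambda>s. s + 1 / 2"]) (auto intro!: derivative_eq_intros)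
  hence "(Q has_field_derivative ((s + 3 / 2 - of_real \<kappa>) + (s + 1 / 2)) * zeta_reg (s + 1 / 2)
      + (s + 1 / 2) * (s + 3 / 2 - of_real \<kappa>) * deriv zeta_reg (s + 1 / 2)) (at s)"
    unfolding Q_def[abs_def] by (auto intro!: derivative_eq_intros simp: field_simps)
  thus ?thesis by (rule DERIV_imp_deriv)
qed

private lemma zeta_reg_half: "zeta_reg (1 / 2) \<noteq> 0" "zeta_reg (1 / 2) = - zeta (1 / 2) / 2"
proof -
  show "zeta_reg (1 / 2) \<noteq> 0" using zeta_reg_real_pos(2)[of "1 / 2"] by auto
  show "zeta_reg (1 / 2) = - zeta (1 / 2) / 2" by (subst zeta_reg_eq) auto
qed

text \<open>On the imaginary axis s + 1/2 never vanishes, and s + 3/2 - \<kappa> only at s = 0 for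
  \<kappa> = 3/2; that is the extra pole behind \<open>c_const\<close>.\<close>

private lemma Q_zero_iff:
  "Q (\<i> * of_real y) = 0 \<longleftrightarrow> (y = 0 \<and> \<kappa> = 3 / 2) \<or> zeta_reg (1 / 2 + \<i> * of_real y) = 0"
proof -
  have "\<i> * of_real y + 1 / 2 \<noteq> 0" by (simp add: complex_eq_iff)
  moreover have "\<i> * of_real y + 3 / 2 - of_real \<kappa> = 0 \<longleftrightarrow> y = 0 \<and> \<kappa> = 3 / 2"
    by (auto simp: complex_eq_iff)
  ultimately show ?thesis by (auto simp: Q_def add.commute)
qed

private lemma deriv_Q_0:
  assumes "\<kappa> = 3 / 2" shows "deriv Q 0 = zeta_reg (1 / 2) / 2"
  unfolding Q_derivative unfolding assms by simp

interpretation laplace_quotient A Q R "3 + 3 * \<bar>\<kappa>\<bar>" C T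
proof
  show "continuous_on UNIV A" unfolding A_def by (intro continuous_intros normalized_integral_exp_continuous)
  show "laplace_conv A x" if "x > 3 + 3 * \<bar>\<kappa>\<bar>" for x
    unfolding A_def by (intro laplace_conv_cmult laplace_normalized_integral(1) that)
  have "(zeta_reg \<circ> (\<lambda>s. s + 1 / 2)) holomorphic_on UNIV"
    by (intro holomorphic_on_compose_gen[OF _ zeta_reg_holomorphic] holomorphic_intros) auto
  thus "Q holomorphic_on UNIV" unfolding Q_def[abs_def] by (auto intro!: holomorphic_intros simp: o_def)
  show "R holomorphic_on UNIV" unfolding R_def[abs_def] by (intro holomorphic_intros)
  show "laplace A (of_real x) * Q (of_real x) = R (of_real x)" if "x > 3 + 3 * \<bar>\<kappa>\<bar>" for x
    using laplace_normalized_integral(2)[OF that] unfolding A_def Q_def R_def laplace_cmult by (simp add: mult.assoc)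
  show "Q (of_real x) \<noteq> 0" if x: "x > 0" for x
  proof -
    \<comment> \<open>Here \<kappa> \<le> 3/2 enters: a larger \<kappa> would put a zero of
      \<open>Q\<close> at s = \<kappa> - 3/2 > 0.\<close>
    have "x + 1 / 2 \<noteq> 0" "x + 3 / 2 - \<kappa> \<noteq> 0" using x kappa by linarith+
    hence "complex_of_real (x + 1 / 2) \<noteq> 0" "complex_of_real (x + 3 / 2 - \<kappa>) \<noteq> 0"
      by (metis of_real_eq_0_iff)+
    moreover have "zeta_reg (of_real (x + 1 / 2)) \<noteq> 0" using zeta_reg_real_pos(2)[of "x + 1 / 2"] x by auto
    ultimately show ?thesis by (simp add: Q_def)
  qed
  show "deriv Q 0 \<noteq> 0" if "Q 0 = 0"
  proof -
    have "\<kappa> = 3 / 2" using that Q_zero_iff[of 0] zeta_reg_half by simp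
    hence "deriv Q 0 = zeta_reg (1 / 2) / 2" by (rule deriv_Q_0)
    moreover have "zeta_reg (1 / 2) / 2 \<noteq> 0" using zeta_reg_half(1) by (simp only: divide_eq_0_iff) simp
    ultimately show ?thesis by metis
  qed
  show "R (\<i> * of_real y) \<noteq> 0" for y using sign by (auto simp: R_def complex_eq_iff)
qed (use T le in \<open>auto simp: A_def\<close>)

text \<open>For \<kappa> = 3/2, R(0) = -\<sigma>/2 and Q'(0) = -zeta(1/2)/4, with quotient
  2\<sigma>/zeta(1/2). For other \<kappa> there is no pole at 0, because \<open>zeta_reg\<close>
  does not vanish at 1/2.\<close>

private lemma residue_at_0: "Re (residue_at 0) = \<sigma> * c_const \<kappa>"
proof (cases "\<kappa> = 3 / 2")
  case True
  have "Q 0 = 0" unfolding Q_def unfolding True by simp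
  hence "residue_at 0 = R 0 / deriv Q 0" by (simp add: residue_at_def)
  also have "\<dots> = of_real \<sigma> * (2 / zeta (1 / 2))"
    unfolding deriv_Q_0[OF True] using zeta_reg_half by (simp add: R_def)
  finally have "Re (residue_at 0) = Re (of_real \<sigma> * (2 / zeta (1 / 2)))" by (rule arg_cong)
  also have "Re (of_real \<sigma> * w) = \<sigma> * Re w" for w by simp
  finally have "Re (residue_at 0) = \<sigma> * Re (2 / zeta (1 / 2))" .
  moreover have "c_const \<kappa> = Re (2 / zeta (1 / 2))" unfolding c_const_def using True by simp
  ultimately show ?thesis by simp
next
  case False
  thus ?thesis using Q_zero_iff[of 0] zeta_reg_half by (simp add: residue_at_def c_const_def)
qed

text \<open>Simplicity of the pole, a consequence of the one-sided bound, excludes the infinite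
  branch of \<open>zero_term\<close>. In the residue the factor \<rho> - 1 of Q' cancels against
  \<open>R\<close>, and \<sigma> has modulus 1.\<close>

private lemma residue_at_zero:
  assumes "\<rho> \<in> nontrivial_zeros"
  shows "zero_term \<kappa> \<rho> = ereal (norm (residue_at (Im \<rho>)))"
proof -
  note z = riemann_hypothesis_zeros[OF rh assms]
  define s where "s = \<i> * of_real (Im \<rho>)"
  have s: "s + 1 / 2 = \<rho>" "s + 3 / 2 = \<rho> + 1" "s - 1 / 2 = \<rho> - 1"
    using z(1) by (auto simp: s_def complex_eq_iff)
  have reg: "zeta_reg \<rho> = 0" using z(3,4) by (simp add: zeta_reg_eq)
  have Q0: "Q s = 0" using reg by (simp add: Q_def s)
  have dQ: "deriv Q s = \<rho> * (\<rho> - of_real \<kappa> + 1) * deriv zeta \<rho> * (\<rho> - 1)"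
    by (simp add: Q_derivative s reg deriv_zeta_reg_at_zero[OF z(3,4)] algebra_simps)
  have "deriv Q s \<noteq> 0" using simple_pole[of "Im \<rho>"] Q0 by (simp add: s_def)
  hence "deriv zeta \<rho> \<noteq> 0" using dQ by auto
  moreover have "norm (residue_at (Im \<rho>)) = norm (R s / deriv Q s)"
    using Q0 by (simp add: residue_at_def s_def)
  moreover have "R s / deriv Q s = of_real \<sigma> / (\<rho> * (\<rho> - of_real \<kappa> + 1) * deriv zeta \<rho>)"
    using z(3) by (simp add: R_def s dQ)
  ultimately show ?thesis using sign by (simp add: zero_term_def norm_divide)
qed

text \<open>If the combination y met a zero of \<open>Q\<close>, then |y| would be an ordinate, and
  moving it to the other side would give an integer relation among ordinates. As |y| equals at most
  one of \<gamma>1 and \<gamma>2, a nonzero coefficient survives at the other.\<close>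

private lemma independent_combinations:
  fixes e :: "real \<Rightarrow> int"
  assumes G: "finite G" "G \<subseteq> positive_ordinates"
    and e: "\<gamma>1 \<in> G" "\<gamma>2 \<in> G" "\<gamma>1 \<noteq> \<gamma>2" "e \<gamma>1 \<noteq> 0" "e \<gamma>2 \<noteq> 0"
  shows "(\<Sum>\<gamma>\<in>G. of_int (e \<gamma>) * \<gamma>) \<noteq> 0" "Q (\<i> * of_real (\<Sum>\<gamma>\<in>G. of_int (e \<gamma>) * \<gamma>)) \<noteq> 0"
proof -
  define y where "y = (\<Sum>\<gamma>\<in>G. of_int (e \<gamma>) * \<gamma>)"
  have y: "y \<noteq> 0" using int_combination_zero[OF lic G, of e] e by (auto simp: y_def)
  have "Q (\<i> * of_real y) \<noteq> 0"
  proof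
    assume "Q (\<i> * of_real y) = 0"
    hence a: "\<bar>y\<bar> \<in> positive_ordinates" using y by (simp add: Q_zero_iff zeta_reg_zero_ordinate)
    define \<tau> :: int where "\<tau> = (if y > 0 then 1 else -1)"
    define u where "u = (\<lambda>x. (if x \<in> G then e x else 0) - (if x = \<bar>y\<bar> then \<tau> else 0))"
    have "(\<Sum>x\<in>insert \<bar>y\<bar> G. of_int (u x) * x)
        = (\<Sum>x\<in>insert \<bar>y\<bar> G. if x \<in> G then of_int (e x) * x else 0) - (\<Sum>x\<in>insert \<bar>y\<bar> G. if x = \<bar>y\<bar> then of_int \<tau> * x else 0)"
      unfolding sum_subtractf[symmetric] by (intro sum.cong refl) (auto simp: u_def algebra_simps)
    also have "(\<Sum>x\<in>insert \<bar>y\<bar> G. if x \<in> G then of_int (e x) * x else 0) = y"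
      unfolding y_def by (rule sum.mono_neutral_cong_right) (use G in auto)
    also have "(\<Sum>x\<in>insert \<bar>y\<bar> G. if x = \<bar>y\<bar> then of_int \<tau> * x else 0) = of_int \<tau> * \<bar>y\<bar>"
      using G by (simp add: sum.delta)
    also have "y - of_int \<tau> * \<bar>y\<bar> = 0" by (simp add: \<tau>_def)
    finally have sum0: "(\<Sum>x\<in>insert \<bar>y\<bar> G. of_int (u x) * x) = 0" .
    have "u x = 0" if "x \<in> G" for x
      by (rule int_combination_zero[OF lic _ _ sum0]) (use G a that in auto)
    from this[OF e(1)] this[OF e(2)] e show False by (auto simp: u_def split: if_splits)
  qed
  with y show "(\<Sum>\<gamma>\<in>G. of_int (e \<gamma>) * \<gamma>) \<noteq> 0" "Q (\<i> * of_real (\<Sum>\<gamma>\<in>G. of_int (e \<gamma>) * \<gamma>)) \<noteq> 0"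
    unfolding y_def by auto
qed

text \<open>Zeros are grouped by the absolute value of the ordinate: at most \<rho> and its
  conjugate in each group, with residues of equal modulus. \<open>F\<close> may contain only one of
  the two, hence an inequality; the factor 2 becomes the 1/2 of the theorem.\<close>

private lemma finite_zero_sum_le:
  assumes F: "finite F" "F \<subseteq> nontrivial_zeros"
  shows "(\<Sum>\<rho>\<in>F. zero_term \<kappa> \<rho>) \<le> ereal (2 * (C - \<sigma> * c_const \<kappa>))"
proof -
  define G where "G = (\<lambda>\<rho>. \<bar>Im \<rho>\<bar>) ` F"
  have "\<bar>Im \<rho>\<bar> \<in> positive_ordinates" if "\<rho> \<in> F" for \<rho>
  proof (rule zeta_reg_zero_ordinate)
    note z = riemann_hypothesis_zeros[OF rh subsetD[OF F(2) that]]
    show "zeta_reg (1 / 2 + \<i> * of_real (Im \<rho>)) = 0"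
      using z by (metis mult_zero_right zeta_reg_eq)
  qed
  hence G: "finite G" "G \<subseteq> positive_ordinates" using F by (auto simp: G_def)
  have "(\<Sum>\<rho>\<in>F. norm (residue_at (Im \<rho>))) = (\<Sum>\<gamma>\<in>G. \<Sum>\<rho>\<in>{\<rho>\<in>F. \<bar>Im \<rho>\<bar> = \<gamma>}. norm (residue_at (Im \<rho>)))"
    unfolding G_def by (rule sum.image_gen[OF F(1)])
  also have "\<dots> \<le> (\<Sum>\<gamma>\<in>G. 2 * norm (residue_at \<gamma>))"
  proof (rule sum_mono)
    fix \<gamma> assume "\<gamma> \<in> G"
    hence pos: "\<gamma> > 0" using G by (auto simp: positive_ordinates_def)
    define p where "p = (\<lambda>y. 1 / 2 + \<i> * complex_of_real y)"
    have "\<rho> = p (Im \<rho>)" if "\<rho> \<in> F" for \<rho>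
      using riemann_hypothesis_zeros(1)[OF rh subsetD[OF F(2) that]] by (simp add: p_def)
    hence "{\<rho>\<in>F. \<bar>Im \<rho>\<bar> = \<gamma>} \<subseteq> {p \<gamma>, p (- \<gamma>)}" by (auto simp: abs_if split: if_splits)
    hence "(\<Sum>\<rho>\<in>{\<rho>\<in>F. \<bar>Im \<rho>\<bar> = \<gamma>}. norm (residue_at (Im \<rho>))) \<le> (\<Sum>\<rho>\<in>{p \<gamma>, p (- \<gamma>)}. norm (residue_at (Im \<rho>)))"
      by (intro sum_mono2) auto
    also have "\<dots> = 2 * norm (residue_at \<gamma>)"
    proof -
      have "p \<gamma> \<noteq> p (- \<gamma>)" using pos by (simp add: p_def complex_eq_iff)
      thus ?thesis by (simp add: p_def residue_at_minus)
    qed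
    finally show "(\<Sum>\<rho>\<in>{\<rho>\<in>F. \<bar>Im \<rho>\<bar> = \<gamma>}. norm (residue_at (Im \<rho>))) \<le> 2 * norm (residue_at \<gamma>)" .
  qed
  also have "\<dots> \<le> 2 * (C - \<sigma> * c_const \<kappa>)"
  proof -
    have "Re (residue_at 0) + (\<Sum>\<gamma>\<in>G. norm (residue_at \<gamma>)) \<le> C"
      using G independent_combinations[OF G] by (intro sum_residues_le) (auto simp: positive_ordinates_def)
    thus ?thesis by (simp add: residue_at_0 flip: sum_distrib_left)
  qed
  finally have "ereal (\<Sum>\<rho>\<in>F. norm (residue_at (Im \<rho>))) \<le> ereal (2 * (C - \<sigma> * c_const \<kappa>))" by simp
  also have "ereal (\<Sum>\<rho>\<in>F. norm (residue_at (Im \<rho>))) = (\<Sum>\<rho>\<in>F. zero_term \<kappa> \<rho>)"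
    unfolding sum_ereal[symmetric] using F by (intro sum.cong) (auto simp: residue_at_zero)
  finally show ?thesis .
qed

lemma zero_sum_le: "zero_sum \<kappa> \<le> ereal (2 * (C - \<sigma> * c_const \<kappa>))"
proof -
  have "zero_sum \<kappa> = (SUP F\<in>{F. finite F \<and> F \<subseteq> nontrivial_zeros}. sum (zero_term \<kappa>) F)"
    unfolding zero_sum_def by (rule nonneg_infsum_complete) (simp add: zero_term_def)
  also have "\<dots> \<le> ereal (2 * (C - \<sigma> * c_const \<kappa>))"
    using finite_zero_sum_le by (intro SUP_least) blast
  finally show ?thesis .
qed

end

lemma zero_sum_nonneg: "zero_sum \<kappa> \<ge> 0"
  unfolding zero_sum_def by (rule infsum_nonneg) (simp add: zero_term_def)

text \<open>An eventual one-sided bound makes the sum over zeros finite; naming its half as a real r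
  leaves an inequality between reals.\<close>

lemma zero_sum_bound:
  assumes "linear_independence_conjecture" "\<kappa> \<le> 3 / 2" "\<bar>\<sigma>\<bar> = 1"
    and "eventually (\<lambda>x. \<sigma> * normalized_integral \<kappa> x \<le> C) at_top"
  obtains r where "1 / 2 * zero_sum \<kappa> = ereal r" "\<sigma> * c_const \<kappa> + r \<le> C"
proof -
  have "eventually (\<lambda>t. \<sigma> * normalized_integral \<kappa> (exp t) \<le> C) at_top"
    using assms(4) exp_at_top by (rule eventually_compose_filterlim)
  then obtain T0 where "\<And>t. t \<ge> T0 \<Longrightarrow> \<sigma> * normalized_integral \<kappa> (exp t) \<le> C"
    by (auto simp: eventually_at_top_linorder)
  hence *: "zero_sum \<kappa> \<le> ereal (2 * (C - \<sigma> * c_const \<kappa>))"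
    by (intro zero_sum_le[OF assms(1-3), of "max 0 T0"]) auto
  obtain r where r: "zero_sum \<kappa> = ereal r" using * zero_sum_nonneg[of \<kappa>] by (cases "zero_sum \<kappa>") auto
  have "1 / 2 * zero_sum \<kappa> = ereal (r / 2)" unfolding r by (simp add: numeral_eq_ereal one_ereal_def)
  moreover have "\<sigma> * c_const \<kappa> + r / 2 \<le> C" using * r by (simp add: field_simps)
  ultimately show thesis by (rule that)
qed

theorem theorem5:
  fixes \<kappa> :: real
  assumes "linear_independence_conjecture"
    and "\<kappa> \<le> 3 / 2"
  shows "Limsup at_top (\<lambda>x. ereal (normalized_integral \<kappa> x)) \<ge> ereal (c_const \<kappa>) + 1 / 2 * zero_sum \<kappa>
       \<and> Liminf at_top (\<lambda>x. ereal (normalized_integral \<kappa> x)) \<le> ereal (c_const \<kappa>) - 1 / 2 * zero_sum \<kappa>"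
proof (intro conjI; rule ccontr)
  assume "\<not> Limsup at_top (\<lambda>x. ereal (normalized_integral \<kappa> x)) \<ge> ereal (c_const \<kappa>) + 1 / 2 * zero_sum \<kappa>"
  \<comment> \<open>A real number strictly between the two sides: it bounds the integral eventually
    and yet is smaller than the claimed value.\<close>
  then obtain C where C: "Limsup at_top (\<lambda>x. ereal (normalized_integral \<kappa> x)) < ereal C"
      "ereal C < ereal (c_const \<kappa>) + 1 / 2 * zero_sum \<kappa>"
    using ereal_dense2 by (meson not_le)
  have "eventually (\<lambda>x. ereal (normalized_integral \<kappa> x) < ereal C) at_top" by (rule Limsup_lessD[OF C(1)])
  hence "eventually (\<lambda>x. 1 * normalized_integral \<kappa> x \<le> C) at_top" by eventually_elim simp
  then obtain r where "1 / 2 * zero_sum \<kappa> = ereal r" "1 * c_const \<kappa> + r \<le> C"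
    using zero_sum_bound[OF assms, of 1 C] by auto
  thus False using C(2) by simp
next
  assume "\<not> Liminf at_top (\<lambda>x. ereal (normalized_integral \<kappa> x)) \<le> ereal (c_const \<kappa>) - 1 / 2 * zero_sum \<kappa>"
  then obtain D where D: "ereal (c_const \<kappa>) - 1 / 2 * zero_sum \<kappa> < ereal D"
      "ereal D < Liminf at_top (\<lambda>x. ereal (normalized_integral \<kappa> x))"
    using ereal_dense2 by (meson not_le)
  have "eventually (\<lambda>x. ereal D < ereal (normalized_integral \<kappa> x)) at_top" by (rule less_LiminfD[OF D(2)])
  \<comment> \<open>The lower limit is handled by negation, with \<sigma> = -1 and the constant
    -D.\<close>
  hence "eventually (\<lambda>x. (- 1) * normalized_integral \<kappa> x \<le> - D) at_top" by eventually_elim simp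
  then obtain r where "1 / 2 * zero_sum \<kappa> = ereal r" "(- 1) * c_const \<kappa> + r \<le> - D"
    using zero_sum_bound[OF assms, of "- 1" "- D"] by auto
  thus False using D(1) by simp
qed

end
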